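(* Let $\varphi$ be a continuous random dynamical system on the Polish space $E$ (equipped with the metric $d$) over the metric dynamical system $(\Omega,\mathscr F,P,(\vartheta_t)_{t\in\mathbb R})$. The following are equivalent: (i) $\varphi$ has a weak $B$-attractor. (ii) For every $\varepsilon>0$ there exists a compact subset $C_\varepsilon\subset E$ such that for each $\delta>0$ and each bounded subset $B$ of $E$ there is a $t_0>0$ with the property that for all $t\ge t_0$, $$P\bigl\{\varphi(t,\omega)(B)\subset C_\varepsilon^\delta\bigr\}\ge 1-\varepsilon .$$ (iii) There exists a compact weakly $B$-attracting set $\omega\mapsto K(\omega)$, i.e. a compact random set $K$ which weakly attracts every bounded subset of $E$.
   Context: $E$ is a Polish space with Borel $\sigma$-algebra $\mathscr B$, equipped with a complete metric $d$ inducing its topology; "bounded" is with respect to $d$. For $x\in E$, $A\subset E$: $d(x,A)=\inf_{a\in A}d(x,a)$; for non-empty sets, $d(B,A)=\sup_{b\in B}d(b,A)$. For $A\subset E$ and $\delta>0$, $A^\delta$ is the closed $\delta$-neighbourhood of $A$. A metric dynamical system $(\Omega,\mathscr F,P,(\vartheta_t)_{t\in\mathbb R})$ is a probability space with maps $\vartheta_t:\Omega\to\Omega$ such that $(\omega,t)\mapsto\vartheta_t\omega$ is $(\mathscr F\otimes\mathscr B(\mathbb R),\mathscr F)$-measurable, $\vartheta_{s+t}=\vartheta_s\circ\vartheta_t$, $\vartheta_0=\mathrm{Id}_\Omega$, and each $\vartheta_t$ preserves $P$. A random dynamical system (RDS) is a $(\mathscr B([0,\infty))\otimes\mathscr B\otimes\mathscr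 F,\mathscr B)$-measurable map $\varphi:[0,\infty)\times E\times\Omega\to E$, $(t,x,\omega)\mapsto\varphi(t,x,\omega)=\varphi(t,\omega)(x)$, with $\varphi(0,\omega)=\mathrm{Id}_E$ and $\varphi(t+s,\omega)=\varphi(t,\vartheta_s\omega)\circ\varphi(s,\omega)$ for all $s,t\ge0$, $\omega\in\Omega$. It is continuous if $x\mapsto\varphi(t,x,\omega)$ is continuous for all $(t,\omega)$; no continuity in $t$ is assumed. A compact random set is a map $\omega\mapsto A(\omega)$ with values in the compact subsets of $E$ such that $\omega\mapsto d(x,A(\omega))$ is measurable for every $x\in E$; random sets are assumed non-empty almost surely. A compact random set $K$ weakly attracts a (deterministic) set $B\subset E$ if $d(\varphi(t,\vartheta_{-t}\omega)B,K(\omega))\to0$ in probability as $t\to\infty$. A weak $B$-attractor is a compact random set $A$ such that (a) $A$ is strictly $\varphi$-invariant: for each $t\ge0$ there is a set $\Omega_t$ of full measure with $\varphi(t,\omega)(A(\omega))=A(\vartheta_t\omega)$ for all $\omega\in\Omega_t$; and (b) for every bounded $B\subset E$, $\lim_{t\to\infty}\sup_{x\in B}d(\varphi(t,\omega)(x),A(\vartheta_t\omega))=0$ in probability. *)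

theory Defs
  imports "HOL-Probability.Probability"
begin

section \<open>Distances to sets\<close>

text \<open>The distances take values in \<^typ>\<open>ennreal\<close> instead of using \<^const>\<open>infdist\<close>: a random set may be
  empty on a null set, where the infimum over the empty set has to be infinite (whereas \<^const>\<open>infdist\<close>
  is then \<open>0\<close>), and the supremum over an image of a bounded set may be infinite.\<close>

definition pt_dist :: "'a::metric_space \<Rightarrow> 'a set \<Rightarrow> ennreal"
  where "pt_dist x A = (INF a\<in>A. ennreal (dist x a))"

definition semi_dist :: "'a::metric_space set \<Rightarrow> 'a set \<Rightarrow> ennreal"
  where "semi_dist B A = (SUP b\<in>B. pt_dist b A)"

definition closed_nbhd :: "'a::metric_space set \<Rightarrow> real \<Rightarrow> 'a set"
  where "closed_nbhd A \<delta> = {x. pt_dist x A \<le> ennreal \<delta>}"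

lemma pt_dist_eq_infdist:
  assumes "A \<noteq> {}"
  shows "pt_dist x A = ennreal (infdist x A)"
proof (rule antisym)
  show "ennreal (infdist x A) \<le> pt_dist x A"
    unfolding pt_dist_def by (intro INF_greatest ennreal_leI infdist_le)
  show "pt_dist x A \<le> ennreal (infdist x A)"
  proof (rule ennreal_le_epsilon)
    fix e :: real
    assume "0 < e"
    then have "(INF a\<in>A. dist x a) < infdist x A + e"
      using assms by (simp add: infdist_notempty)
    then obtain a where "a \<in> A" "dist x a < infdist x A + e"
      using assms by (subst (asm) cINF_less_iff) auto
    then have "pt_dist x A \<le> ennreal (infdist x A + e)"
      unfolding pt_dist_def by (intro INF_lower2[of a] ennreal_leI) auto
    then show "pt_dist x A \<le> ennreal (infdist x A) + ennreal e"
      using \<open>0 < e\<close> by (simp add: infdist_nonneg)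
  qed
qed

section \<open>Random dynamical systems\<close>

text \<open>The set \<open>\<Omega>\<close> is \<^term>\<open>space M\<close>; all requirements are relative to it.\<close>

locale metric_dynamical_system = prob_space M
  for M :: "'w measure" +
  fixes \<theta> :: "real \<Rightarrow> 'w \<Rightarrow> 'w"
  assumes measurable_flow: "(\<lambda>(\<omega>, t). \<theta> t \<omega>) \<in> M \<Otimes>\<^sub>M borel \<rightarrow>\<^sub>M M"
    and flow_add: "\<omega> \<in> space M \<Longrightarrow> \<theta> (s + t) \<omega> = \<theta> s (\<theta> t \<omega>)"
    and flow_zero: "\<omega> \<in> space M \<Longrightarrow> \<theta> 0 \<omega> = \<omega>"
    and flow_preserving: "distr M M (\<theta> t) = M"

text \<open>The class \<^class>\<open>polish_space\<close> provides a separable space together with a complete metric \<^const>\<open>dist\<close>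
  inducing its topology. The time argument of \<open>\<phi>\<close> has type \<^typ>\<open>real\<close>, but only its values on \<open>[0, \<infinity>)\<close> are
  ever constrained or used.\<close>

locale random_dynamical_system = metric_dynamical_system M \<theta>
  for M :: "'w measure" and \<theta> :: "real \<Rightarrow> 'w \<Rightarrow> 'w" +
  fixes \<phi> :: "real \<Rightarrow> 'w \<Rightarrow> 'e::polish_space \<Rightarrow> 'e"
  assumes measurable_rds:
      "(\<lambda>(t, x, \<omega>). \<phi> t \<omega> x) \<in> restrict_space borel {0..} \<Otimes>\<^sub>M (borel \<Otimes>\<^sub>M M) \<rightarrow>\<^sub>M borel"
    and rds_zero: "\<omega> \<in> space M \<Longrightarrow> \<phi> 0 \<omega> = id"
    and rds_cocycle:
      "\<omega> \<in> space M \<Longrightarrow> 0 \<le> s \<Longrightarrow> 0 \<le> t \<Longrightarrow> \<phi> (t + s) \<omega> = \<phi> t (\<theta> s \<omega>) \<circ> \<phi> s \<omega>"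

locale continuous_rds = random_dynamical_system M \<theta> \<phi>
  for M :: "'w measure" and \<theta> :: "real \<Rightarrow> 'w \<Rightarrow> 'w"
    and \<phi> :: "real \<Rightarrow> 'w \<Rightarrow> 'e::polish_space \<Rightarrow> 'e" +
  assumes continuous_rds: "\<omega> \<in> space M \<Longrightarrow> 0 \<le> t \<Longrightarrow> continuous_on UNIV (\<phi> t \<omega>)"

section \<open>Random sets and attraction\<close>

definition compact_random_set :: "'w measure \<Rightarrow> ('w \<Rightarrow> 'e::polish_space set) \<Rightarrow> bool"
  where "compact_random_set M A \<longleftrightarrow>
    (\<forall>\<omega>\<in>space M. compact (A \<omega>)) \<and>
    (\<forall>x. (\<lambda>\<omega>. pt_dist x (A \<omega>)) \<in> borel_measurable M) \<and>
    (AE \<omega> in M. A \<omega> \<noteq> {})"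

text \<open>Convergence to \<open>0\<close> in probability as \<open>t \<rightarrow> \<infinity>\<close>. The families \<open>X\<close> below are suprema over arbitrary
  bounded sets \<open>B\<close>; for a continuous random dynamical system and a compact random set they are
  nevertheless measurable, because \<open>B\<close> may be replaced by a countable dense subset. The same holds
  for the events that \<open>\<phi> t \<omega> ` B\<close> is contained in a closed neighbourhood.\<close>

definition tendsto_zero_in_prob :: "'w measure \<Rightarrow> (real \<Rightarrow> 'w \<Rightarrow> ennreal) \<Rightarrow> bool"
  where "tendsto_zero_in_prob M X \<longleftrightarrow>
    (\<forall>\<epsilon>::real. \<epsilon> > 0 \<longrightarrow> ((\<lambda>t. \<P>(\<omega> in M. X t \<omega> > ennreal \<epsilon>)) \<longlongrightarrow> 0) at_top)"

definition weakly_attracts ::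
    "'w measure \<Rightarrow> (real \<Rightarrow> 'w \<Rightarrow> 'w) \<Rightarrow> (real \<Rightarrow> 'w \<Rightarrow> 'e \<Rightarrow> 'e) \<Rightarrow>
      ('w \<Rightarrow> 'e::polish_space set) \<Rightarrow> 'e set \<Rightarrow> bool"
  where "weakly_attracts M \<theta> \<phi> K B \<longleftrightarrow>
    tendsto_zero_in_prob M (\<lambda>t \<omega>. semi_dist (\<phi> t (\<theta> (- t) \<omega>) ` B) (K \<omega>))"

definition strictly_invariant ::
    "'w measure \<Rightarrow> (real \<Rightarrow> 'w \<Rightarrow> 'w) \<Rightarrow> (real \<Rightarrow> 'w \<Rightarrow> 'e \<Rightarrow> 'e) \<Rightarrow> ('w \<Rightarrow> 'e set) \<Rightarrow> bool"
  where "strictly_invariant M \<theta> \<phi> A \<longleftrightarrow>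
    (\<forall>t\<ge>0. AE \<omega> in M. \<phi> t \<omega> ` A \<omega> = A (\<theta> t \<omega>))"

definition weak_B_attractor ::
    "'w measure \<Rightarrow> (real \<Rightarrow> 'w \<Rightarrow> 'w) \<Rightarrow> (real \<Rightarrow> 'w \<Rightarrow> 'e \<Rightarrow> 'e) \<Rightarrow>
      ('w \<Rightarrow> 'e::polish_space set) \<Rightarrow> bool"
  where "weak_B_attractor M \<theta> \<phi> A \<longleftrightarrow>
    compact_random_set M A \<and>
    strictly_invariant M \<theta> \<phi> A \<and>
    (\<forall>B. bounded B \<longrightarrow>
      tendsto_zero_in_prob M (\<lambda>t \<omega>. SUP x\<in>B. pt_dist (\<phi> t \<omega> x) (A (\<theta> t \<omega>))))"

end

theory Submission
  imports Defs
begin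

text \<open>Tightness produces the attractor as follows. Let \<open>C\<^sub>k\<close> be compact sets absorbing every bounded set up to
  probability \<open>2\<^sup>-\<^sup>k\<close> and let \<open>K\<^sub>k(\<omega>)\<close> be the image of \<open>C\<^sub>k\<close> under \<open>\<phi>(\<tau>\<^sub>k, \<theta>\<^bsub>-\<tau>\<^sub>k\<^esub>\<omega>)\<close>. Between the
  times \<open>-\<tau>\<^sub>l\<close> and \<open>-\<tau>\<^sub>k\<close> the set \<open>C\<^sub>l\<close> is mapped close to \<open>C\<^sub>k\<close>, so continuity near the compact set \<open>C\<^sub>k\<close>
  places \<open>K\<^sub>l\<close> in a small neighbourhood of \<open>K\<^sub>k\<close>. If \<open>\<tau>\<^sub>k\<close> grows fast enough, Borel-Cantelli makes these
  inclusions summable almost surely, the \<open>K\<^sub>k\<close> converge in the Hausdorff metric, and the limit \<open>A\<close> attracts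
  bounded sets because each \<open>K\<^sub>k\<close> does so up to a small probability. Invariance holds because
  \<open>\<phi>(t, \<omega>) K\<^sub>k(\<omega>)\<close> is a set of the same kind over \<open>\<theta>\<^sub>t\<omega>\<close>, with \<open>\<tau>\<^sub>k + t\<close> in place of \<open>\<tau>\<^sub>k\<close>, and any
  two such families absorb each other in the limit. Conversely, a random compact set lies in a
  deterministic compact set with probability close to one, which yields tightness from attraction.\<close>

section \<open>Approximate inclusion of sets\<close>

text \<open>A strict, witness-based form of the one-sided Hausdorff distance: radii add under
  composition and no infimum has to be attained. If \<open>T\<close> is empty, only an empty
  \<open>S\<close> qualifies.\<close>

definition approx_in :: "real \<Rightarrow> 'a::metric_space set \<Rightarrow> 'a set \<Rightarrow> bool"
  where "approx_in \<delta> S T \<longleftrightarrow> (\<forall>x\<in>S. \<exists>y\<in>T. dist x y < \<delta>)"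

lemma approx_in_trans:
  assumes "approx_in a S T" "approx_in b T U" "a + b \<le> c"
  shows "approx_in c S U"
  unfolding approx_in_def
proof
  fix x assume "x \<in> S"
  then obtain y where y: "y \<in> T" "dist x y < a" using assms(1) by (auto simp: approx_in_def)
  then obtain z where z: "z \<in> U" "dist y z < b" using assms(2) by (auto simp: approx_in_def)
  then show "\<exists>z\<in>U. dist x z < c"
    using y assms(3) dist_triangle[of x z y] by (intro bexI[of _ z]) auto
qed

lemma approx_in_mono:
  "approx_in a S T \<Longrightarrow> a \<le> b \<Longrightarrow> S' \<subseteq> S \<Longrightarrow> T \<subseteq> T' \<Longrightarrow> approx_in b S' T'"
  unfolding approx_in_def by (meson order.strict_trans2 subset_iff)

lemma approx_in_subset: "0 < a \<Longrightarrow> S \<subseteq> T \<Longrightarrow> approx_in a S T"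
  unfolding approx_in_def by (metis dist_self subset_iff)

lemma subset_of_approx_in:
  assumes "closed T" "\<And>n. approx_in (1 / real (Suc n)) S T"
  shows "S \<subseteq> T"
proof
  fix x assume x: "x \<in> S"
  have "\<exists>y\<in>T. dist y x < e" if "0 < e" for e
  proof -
    obtain n where "1 / real (Suc n) < e" using \<open>0 < e\<close> nat_approx_posE by blast
    then show ?thesis using assms(2)[of n] x unfolding approx_in_def
      by (metis dist_commute order.strict_trans)
  qed
  then show "x \<in> T" using assms(1) by (metis closed_approachable)
qed

section \<open>Semi-distances and their measurability\<close>

lemma semi_dist_le_iff:
  "semi_dist S T \<le> c \<longleftrightarrow> (\<forall>x\<in>S. pt_dist x T \<le> c)"
  unfolding semi_dist_def by (rule SUP_le_iff)

lemma pt_dist_less_iff: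
  "pt_dist x T < ennreal \<delta> \<longleftrightarrow> (\<exists>y\<in>T. dist x y < \<delta>)"
  unfolding pt_dist_def by (auto simp: INF_less_iff ennreal_less_iff)

lemma pt_dist_le_of_approx_in: "approx_in \<delta> S T \<Longrightarrow> x \<in> S \<Longrightarrow> pt_dist x T \<le> ennreal \<delta>"
  unfolding approx_in_def using pt_dist_less_iff by (metis less_imp_le)

lemma semi_dist_le_of_approx_in: "approx_in \<delta> S T \<Longrightarrow> semi_dist S T \<le> ennreal \<delta>"
  by (simp add: semi_dist_le_iff pt_dist_le_of_approx_in)

text \<open>The radius grows strictly because the infimum in \<open>pt_dist\<close> need not be
  attained. Hence the recurrent device of bounding a semi-distance by half of the desired
  radius.\<close>

lemma approx_in_of_semi_dist:
  assumes "semi_dist S T \<le> ennreal \<delta>" "0 \<le> \<delta>" "\<delta> < \<delta>'"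
  shows "approx_in \<delta>' S T"
  unfolding approx_in_def
proof
  fix x assume "x \<in> S"
  then have "pt_dist x T \<le> ennreal \<delta>" using assms(1) by (simp add: semi_dist_le_iff)
  also have "\<dots> < ennreal \<delta>'" using assms by (simp add: ennreal_less_iff)
  finally show "\<exists>y\<in>T. dist x y < \<delta>'" by (simp add: pt_dist_less_iff)
qed

lemma subset_closed_nbhd_of_approx_in: "approx_in \<delta> S T \<Longrightarrow> S \<subseteq> closed_nbhd T \<delta>"
  by (auto simp: closed_nbhd_def pt_dist_le_of_approx_in)

lemma subset_closed_nbhd_iff: "S \<subseteq> closed_nbhd T \<delta> \<longleftrightarrow> semi_dist S T \<le> ennreal \<delta>"
  by (auto simp: closed_nbhd_def semi_dist_le_iff)

lemma pt_dist_triangle: "pt_dist x T \<le> ennreal (dist x y) + pt_dist y T"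
proof (rule ennreal_le_epsilon)
  fix e :: real assume e: "0 < e" and fin: "ennreal (dist x y) + pt_dist y T < top"
  then obtain r where r: "pt_dist y T = ennreal r" "0 \<le> r"
    by (cases "pt_dist y T") (auto simp: ennreal_add_eq_top)
  then have "pt_dist y T < ennreal (r + e)" using e by (simp add: ennreal_less_iff)
  then obtain z where z: "z \<in> T" "dist y z < r + e" by (auto simp: pt_dist_less_iff)
  have "pt_dist x T \<le> ennreal (dist x z)"
    unfolding pt_dist_def using z(1) by (rule INF_lower)
  also have "\<dots> \<le> ennreal (dist x y + r + e)"
    using z(2) dist_triangle[of x z y] by (intro ennreal_leI) auto
  also have "\<dots> = ennreal (dist x y) + pt_dist y T + ennreal e"
    using r e by simp
  finally show "pt_dist x T \<le> ennreal (dist x y) + pt_dist y T + ennreal e" .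
qed

lemma pt_dist_le_add:
  assumes "semi_dist S T \<le> c"
  shows "pt_dist x T \<le> pt_dist x S + c"
proof (rule ennreal_le_epsilon)
  fix e :: real assume e: "0 < e" and fin: "pt_dist x S + c < top"
  then obtain r where r: "pt_dist x S = ennreal r" "0 \<le> r"
    by (cases "pt_dist x S") auto
  then have "pt_dist x S < ennreal (r + e)" using e by (simp add: ennreal_less_iff)
  then obtain s where s: "s \<in> S" "dist x s < r + e" by (auto simp: pt_dist_less_iff)
  have "pt_dist x T \<le> ennreal (dist x s) + pt_dist s T" by (rule pt_dist_triangle)
  also have "\<dots> \<le> ennreal (r + e) + c"
    using s assms by (intro add_mono ennreal_leI) (auto simp: semi_dist_le_iff)
  also have "\<dots> = pt_dist x S + c + ennreal e"
    using r e by (simp add: ac_simps)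
  finally show "pt_dist x T \<le> pt_dist x S + c + ennreal e" .
qed

lemma dense_setE:
  obtains D :: "'a::{metric_space, second_countable_topology} set"
  where "countable D" "closure D = UNIV"
  using separable[of "UNIV :: 'a set"] by (metis top.extremum_unique)

lemma dense_approachable:
  assumes "closure D = UNIV" "0 < e"
  shows "\<exists>x\<in>D. dist x y < e"
  using assms closure_approachable[of y D] by auto

text \<open>The reason why semi-distances of random sets are measurable: countably many conditions suffice.\<close>

lemma semi_dist_le_iff_dense:
  assumes "closure D = UNIV"
  shows "semi_dist S T \<le> c \<longleftrightarrow> (\<forall>x\<in>D. pt_dist x T \<le> pt_dist x S + c)"
proof
  show "semi_dist S T \<le> c \<Longrightarrow> \<forall>x\<in>D. pt_dist x T \<le> pt_dist x S + c"
    using pt_dist_le_add by blast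
  assume *: "\<forall>x\<in>D. pt_dist x T \<le> pt_dist x S + c"
  show "semi_dist S T \<le> c"
    unfolding semi_dist_le_iff
  proof
    fix s assume s: "s \<in> S"
    show "pt_dist s T \<le> c"
    proof (rule ennreal_le_epsilon)
      fix e :: real assume "0 < e"
      then obtain x where x: "x \<in> D" "dist x s < e / 2"
        using dense_approachable[OF assms, of "e/2" s] by auto
      have "pt_dist s T \<le> ennreal (dist s x) + pt_dist x T" by (rule pt_dist_triangle)
      also have "\<dots> \<le> ennreal (e/2) + (ennreal (e/2) + c)"
      proof (intro add_mono)
        show "ennreal (dist s x) \<le> ennreal (e/2)" using x by (intro ennreal_leI) (simp add: dist_commute)
        have "pt_dist x S \<le> ennreal (e/2)"
          using x s by (auto simp: pt_dist_less_iff intro!: less_imp_le)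
        then show "pt_dist x T \<le> ennreal (e/2) + c"
          using * x(1) by (meson add_right_mono order_trans)
      qed
      also have "\<dots> = c + (ennreal (e/2) + ennreal (e/2))" by (simp add: ac_simps)
      also have "ennreal (e/2) + ennreal (e/2) = ennreal e"
        using \<open>0 < e\<close> by (subst ennreal_plus[symmetric]) auto
      finally show "pt_dist s T \<le> c + ennreal e" .
    qed
  qed
qed

lemma borel_measurable_semi_dist:
  fixes S T :: "'w \<Rightarrow> 'e::{metric_space, second_countable_topology} set"
  assumes [measurable]: "\<And>x. (\<lambda>\<omega>. pt_dist x (S \<omega>)) \<in> borel_measurable M"
    "\<And>x. (\<lambda>\<omega>. pt_dist x (T \<omega>)) \<in> borel_measurable M"
  shows "(\<lambda>\<omega>. semi_dist (S \<omega>) (T \<omega>)) \<in> borel_measurable M"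
proof (rule borel_measurableI_le)
  fix c :: ennreal
  obtain D :: "'e set" where D: "countable D" "closure D = UNIV" by (rule dense_setE)
  note [measurable] = D(1)
  show "{\<omega> \<in> space M. semi_dist (S \<omega>) (T \<omega>) \<le> c} \<in> sets M"
    unfolding semi_dist_le_iff_dense[OF D(2)] by measurable
qed

text \<open>Continuity approximates each value on \<open>B\<close> by values on \<open>D\<close>.
  For countable \<open>D\<close> this turns an infimum over an arbitrary set into a countable one,
  which makes distances to images of bounded sets measurable.\<close>

lemma pt_dist_image_dense:
  fixes f :: "'a::metric_space \<Rightarrow> 'b::metric_space"
  assumes "continuous_on UNIV f" "D \<subseteq> B" "B \<subseteq> closure D"
  shows "pt_dist x (f ` B) = pt_dist x (f ` D)"
proof (rule antisym)
  show "pt_dist x (f ` B) \<le> pt_dist x (f ` D)"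
    unfolding pt_dist_def using assms(2) by (intro INF_superset_mono) auto
  show "pt_dist x (f ` D) \<le> pt_dist x (f ` B)"
  proof -
    have "pt_dist x (f ` D) \<le> ennreal (dist x (f b))" if b: "b \<in> B" for b
    proof (rule ennreal_le_epsilon)
      fix e :: real assume e: "0 < e"
      obtain d where d: "0 < d" "\<And>y. dist y b < d \<Longrightarrow> dist (f y) (f b) < e"
        using assms(1) e unfolding continuous_on_iff by (metis UNIV_I)
      obtain y where y: "y \<in> D" "dist y b < d"
        using assms(3) b d(1) closure_approachable[of b D] by auto
      have "pt_dist x (f ` D) \<le> ennreal (dist x (f y))"
        unfolding pt_dist_def using y(1) by (intro INF_lower) auto
      also have "\<dots> \<le> ennreal (dist x (f b) + e)"
        using d(2)[OF y(2)] dist_triangle[of x "f y" "f b"]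
        by (intro ennreal_leI) (auto simp: dist_commute)
      finally show "pt_dist x (f ` D) \<le> ennreal (dist x (f b)) + ennreal e"
        using e by simp
    qed
    then show ?thesis unfolding pt_dist_def[of x "f ` B"] by (auto intro!: INF_greatest)
  qed
qed

section \<open>Compactness\<close>

text \<open>The second point may leave \<open>C\<close>, so uniform continuity on \<open>C\<close>
  would be too weak. A Lebesgue number of the cover of \<open>C\<close> by preimages of balls of
  radius \<open>\<eta>/2\<close> serves as \<open>\<delta>\<close>.\<close>

lemma continuous_uniform_near_compact:
  fixes f :: "'a::metric_space \<Rightarrow> 'b::metric_space"
  assumes "compact C" "continuous_on UNIV f" "0 < \<eta>"
  obtains \<delta> where "0 < \<delta>" "\<And>x y. x \<in> C \<Longrightarrow> dist x y < \<delta> \<Longrightarrow> dist (f x) (f y) < \<eta>"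
proof -
  let ?G = "range (\<lambda>z. f -` ball (f z) (\<eta>/2))"
  have 1: "C \<subseteq> \<Union>?G"
  proof
    fix x
    have "x \<in> f -` ball (f x) (\<eta>/2)" using assms(3) by simp
    then show "x \<in> \<Union>?G" by blast
  qed
  have 2: "open G" if "G \<in> ?G" for G
    using that assms(2) by (auto intro!: open_vimage)
  obtain e where e: "0 < e" "\<And>x. x \<in> C \<Longrightarrow> \<exists>G\<in>?G. ball x e \<subseteq> G"
    using Heine_Borel_lemma[OF assms(1) 1 2] by blast
  show thesis
  proof (rule that[OF e(1)])
    fix x y assume x: "x \<in> C" and y: "dist x y < e"
    obtain z where z: "ball x e \<subseteq> f -` ball (f z) (\<eta>/2)" using e(2)[OF x] by auto
    have "dist (f z) (f x) < \<eta>/2" "dist (f z) (f y) < \<eta>/2"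
      using z y e(1) by (auto simp: subset_iff)
    then show "dist (f x) (f y) < \<eta>"
      using dist_triangle_half_r by blast
  qed
qed

lemma compact_of_totally_bounded:
  fixes S :: "'a::complete_space set"
  assumes "closed S" "\<And>e. 0 < e \<Longrightarrow> \<exists>X. finite X \<and> S \<subseteq> (\<Union>x\<in>X. ball x e)"
  shows "compact S"
  using assms unfolding compact_eq_totally_bounded by (simp add: complete_eq_closed)

text \<open>Cantor intersection: choose a point in each \<open>F n\<close>; a subsequential limit
  lies in every \<open>F n\<close>, since each is closed and contains a tail of the
  subsequence.\<close>

lemma compact_nested_nonempty:
  fixes F :: "nat \<Rightarrow> 'a::metric_space set"
  assumes "compact (F 0)" "\<And>n. closed (F n)" "\<And>n. F n \<noteq> {}" "decseq F"
  shows "(\<Inter>n. F n) \<noteq> {}"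
proof -
  obtain x where x: "\<And>n. x n \<in> F n" using assms(3) unfolding ex_in_conv[symmetric] by metis
  have "\<forall>n. x n \<in> F 0" using x decseqD[OF assms(4), of 0] by auto
  then obtain l r where r: "strict_mono (r :: nat \<Rightarrow> nat)" "(x \<circ> r) \<longlonglongrightarrow> l"
    using assms(1) unfolding compact_def by blast
  have "l \<in> F n" for n
  proof (rule Lim_in_closed_set[OF assms(2) _ _ r(2)])
    show "\<forall>\<^sub>F i in sequentially. (x \<circ> r) i \<in> F n"
      unfolding eventually_sequentially
    proof (intro exI allI impI)
      fix i assume "n \<le> i"
      then have "n \<le> r i" using seq_suble[OF r(1), of i] by simp
      then show "(x \<circ> r) i \<in> F n" using x[of "r i"] decseqD[OF assms(4)] by auto
    qed
  qed simp
  then show ?thesis by auto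
qed

section \<open>Hausdorff limits of almost decreasing compact sets\<close>

text \<open>The Kuratowski upper limit: the points each of whose neighbourhoods meets infinitely
  many \<open>K k\<close>.\<close>

definition limit_set :: "(nat \<Rightarrow> 'a::metric_space set) \<Rightarrow> 'a set"
  where "limit_set K = (\<Inter>n. closure (\<Union>k\<in>{n..}. K k))"

text \<open>The radii of the steps from \<open>k\<close> down to \<open>n\<close> form a geometric
  sum below \<open>2 * (1/2)^n\<close>; the remaining \<open>(1/2)^n\<close> keeps the radius
  positive when \<open>k = n\<close>.\<close>

lemma approx_in_chain:
  assumes step: "\<And>i. n\<^sub>0 \<le> i \<Longrightarrow> approx_in ((1/2)^i) (K (Suc i)) (K i)"
    and "n\<^sub>0 \<le> n" "n \<le> k"
  shows "approx_in (3 * (1/2)^n) (K k) (K n)"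
proof -
  \<comment> \<open>the subtracted term makes the strict bounds of the single steps add up\<close>
  have "approx_in (3 * (1/2)^n - 2 * (1/2)^k) (K k) (K n)"
    using \<open>n \<le> k\<close>
  proof (induction k rule: dec_induct)
    case base
    show ?case by (rule approx_in_subset) auto
  next
    case (step k)
    show ?case
      by (rule approx_in_trans[OF assms(1) step.IH]) (use step assms(2) in auto)
  qed
  then show ?thesis by (rule approx_in_mono) auto
qed

text \<open>One-sided closeness of consecutive sets is enough: it makes the tail closures eventually
  compact, and decreasing compact sets enter every neighbourhood of their intersection.\<close>

lemma limit_set_Hausdorff:
  fixes K :: "nat \<Rightarrow> 'a::complete_space set"
  assumes comp: "\<And>i. compact (K i)" and ne: "\<And>i. K i \<noteq> {}"
    and step: "\<forall>\<^sub>F i in sequentially. approx_in ((1/2)^i) (K (Suc i)) (K i)"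
  shows "compact (limit_set K)" "limit_set K \<noteq> {}"
    and "\<And>\<eta>. 0 < \<eta> \<Longrightarrow>
      \<forall>\<^sub>F k in sequentially. approx_in \<eta> (K k) (limit_set K) \<and> approx_in \<eta> (limit_set K) (K k)"
proof -
  obtain n\<^sub>0 where n0: "\<And>i. n\<^sub>0 \<le> i \<Longrightarrow> approx_in ((1/2)^i) (K (Suc i)) (K i)"
    using step by (auto simp: eventually_sequentially)
  have chain: "approx_in (3 * (1/2)^n) (K k) (K n)" if "n\<^sub>0 \<le> n" "n \<le> k" for n k
    by (rule approx_in_chain[OF _ that]) (rule n0)
  define F where "F n = closure (\<Union>k\<in>{n..}. K k)" for n
  have decF: "F m \<subseteq> F n" if "n \<le> m" for n m
    unfolding F_def using that by (intro closure_mono UN_mono) auto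
  have KF: "K k \<subseteq> F n" if "n \<le> k" for n k
  proof -
    have "K k \<subseteq> (\<Union>k\<in>{n..}. K k)" using that by auto
    then show ?thesis unfolding F_def using closure_subset by blast
  qed
  have near: "\<exists>k\<ge>n. \<exists>y\<in>K k. dist x y < e" if xe: "x \<in> F n" "0 < e" for x n e
  proof -
    obtain y where y: "y \<in> (\<Union>k\<in>{n..}. K k)" "dist y x < e"
      using xe(1)[unfolded F_def closure_approachable, rule_format, OF xe(2)] by (rule bexE)
    then obtain k where "n \<le> k" "y \<in> K k" by auto
    then show ?thesis using y(2) by (intro exI[of _ k] conjI bexI[of _ y]) (simp_all add: dist_commute)
  qed
  \<comment> \<open>The intersection is restarted at \<open>n\<^sub>0\<close>, because the step
    bounds, and with them compactness, hold only from there on.\<close>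
  have lim: "limit_set K = (\<Inter>n. F (n\<^sub>0 + n))"
  proof -
    have "(\<Inter>n. F (n\<^sub>0 + n)) \<subseteq> F n" for n
      using decF[of n "n\<^sub>0 + n"] by (intro order_trans[OF INT_lower[OF UNIV_I]]) simp
    then show ?thesis unfolding limit_set_def F_def[symmetric] by (intro antisym INT_greatest) auto
  qed
  \<comment> \<open>Of the factor 4, the chain takes 3 and the approximation of a closure point
    takes 1.\<close>
  have FK: "approx_in (4 * (1/2)^m) (F m) (K m)" if m: "n\<^sub>0 \<le> m" for m
    unfolding approx_in_def
  proof
    fix x assume "x \<in> F m"
    then obtain k y where y: "m \<le> k" "y \<in> K k" "dist x y < (1/2)^m"
      using near[of x m "(1/2)^m"] by auto
    obtain z where z: "z \<in> K m" "dist y z < 3 * (1/2)^m"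
      using chain[OF m y(1)] y(2) by (auto simp: approx_in_def)
    show "\<exists>z\<in>K m. dist x z < 4 * (1/2)^m"
      using y z dist_triangle[of x z y] by (intro bexI[of _ z]) auto
  qed
  have "compact (F n\<^sub>0)"
  proof (rule compact_of_totally_bounded)
    show "closed (F n\<^sub>0)" unfolding F_def by simp
    fix e :: real assume e: "0 < e"
    obtain m0 where m0: "(1/2)^m0 < e/8" using real_arch_pow_inv[of "e/8" "1/2"] e by auto
    define m where "m = max m0 n\<^sub>0"
    then have "(1/2)^m \<le> (1/2::real)^m0" by (intro power_decreasing) auto
    then have "4 * (1/2)^m < e/2" using m0 by linarith
    moreover have "n\<^sub>0 \<le> m" by (simp add: m_def)
    ultimately have m: "n\<^sub>0 \<le> m" "4 * (1/2)^m < e/2" by auto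
    \<comment> \<open>Finitely many sets suffice for a net: those beyond \<open>m\<close> stay
      within \<open>3 * (1/2)^m\<close> of \<open>K m\<close>, the closure adds
      \<open>(1/2)^m\<close>, and \<open>e/2\<close> is left for the net of
      \<open>Z\<close>.\<close>
    define Z where "Z = (\<Union>k\<in>{n\<^sub>0..m}. K k)"
    have "compact Z" unfolding Z_def using comp by (intro compact_UN) auto
    then obtain X where X: "finite X" "Z \<subseteq> (\<Union>x\<in>X. ball x (e/2))"
      using e unfolding compact_eq_totally_bounded by (metis half_gt_zero)
    have "F n\<^sub>0 \<subseteq> (\<Union>x\<in>X. ball x e)"
    proof
      fix x assume "x \<in> F n\<^sub>0"
      then obtain k y where y: "n\<^sub>0 \<le> k" "y \<in> K k" "dist x y < (1/2)^m"
        using near[of x n\<^sub>0 "(1/2)^m"] by auto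
      have "\<exists>z\<in>Z. dist y z < 3 * (1/2)^m"
      proof (cases "k \<le> m")
        case True
        then show ?thesis using y by (auto simp: Z_def intro!: bexI[of _ y])
      next
        case False
        then obtain z where "z \<in> K m" "dist y z < 3 * (1/2)^m"
          using chain[OF m(1), of k] y(2) by (auto simp: approx_in_def)
        then show ?thesis using m(1) by (auto simp: Z_def)
      qed
      then obtain z where z: "z \<in> Z" "dist y z < 3 * (1/2)^m" by auto
      then obtain u where u: "u \<in> X" "dist u z < e/2" using X(2) by auto
      have "dist u x < e"
        using u z y m dist_triangle[of u x z] dist_triangle[of z x y] by (simp add: dist_commute)
      then show "x \<in> (\<Union>x\<in>X. ball x e)" using u by auto
    qed
    then show "\<exists>X. finite X \<and> F n\<^sub>0 \<subseteq> (\<Union>x\<in>X. ball x e)" using X(1) by auto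
  qed
  moreover have clF: "closed (F n)" for n by (simp add: F_def)
  ultimately have cF: "compact (F (n\<^sub>0 + 0))" by simp
  have decs: "decseq (\<lambda>n. F (n\<^sub>0 + n))" using decF by (auto simp: decseq_def)
  have "closed (limit_set K)" unfolding lim using clF by auto
  moreover have "limit_set K \<subseteq> F (n\<^sub>0 + 0)" unfolding lim by (rule INT_lower) simp
  ultimately show comp_lim: "compact (limit_set K)"
    using cF by (metis compact_Int_closed inf.absorb2)
  have neF: "F n \<noteq> {}" for n using KF[of n n] ne[of n] by auto
  show "limit_set K \<noteq> {}"
    unfolding lim by (rule compact_nested_nonempty[OF cF clF neF decs])
  fix \<eta> :: real assume \<eta>: "0 < \<eta>"
  \<comment> \<open>Otherwise the points of the tail closures at distance at least \<eta> from the
    limit form nested nonempty compact sets; a common point would lie in the limit set and yet be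
    far from it.\<close>
  have "\<exists>n. approx_in \<eta> (F (n\<^sub>0 + n)) (limit_set K)"
  proof (rule ccontr)
    assume contra: "\<not> ?thesis"
    define G where "G n = F (n\<^sub>0 + n) \<inter> (\<Inter>z\<in>limit_set K. {x. \<eta> \<le> dist x z})" for n
    have clD: "closed {x. \<eta> \<le> dist x z}" for z :: 'a
      by (intro closed_Collect_le continuous_intros)
    have cl: "closed (G n)" for n
      unfolding G_def by (intro closed_Int closed_INT ballI clF clD)
    have "compact (G 0)"
      unfolding G_def by (intro compact_Int_closed[OF cF] closed_INT ballI clD)
    moreover have "G n \<noteq> {}" for n
    proof -
      obtain x where "x \<in> F (n\<^sub>0 + n)" "\<forall>z\<in>limit_set K. \<not> dist x z < \<eta>"
        using contra unfolding approx_in_def by blast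
      then have "x \<in> G n" by (simp add: G_def not_less)
      then show ?thesis by blast
    qed
    moreover have "decseq G"
      unfolding decseq_def G_def by (intro allI impI Int_mono decseqD[OF decs] order_refl)
    ultimately obtain x where "x \<in> (\<Inter>n. G n)"
      using compact_nested_nonempty[of G, OF _ cl] by blast
    then have "x \<in> limit_set K" "\<forall>z\<in>limit_set K. \<eta> \<le> dist x z" by (auto simp: G_def lim)
    then have "\<eta> \<le> dist x x" by blast
    then show False using \<eta> by simp
  qed
  then obtain n where n: "approx_in \<eta> (F (n\<^sub>0 + n)) (limit_set K)" by auto
  obtain m0 where m0: "(1/2)^m0 < \<eta>/4" using real_arch_pow_inv[of "\<eta>/4" "1/2"] \<eta> by auto
  show "\<forall>\<^sub>F k in sequentially. approx_in \<eta> (K k) (limit_set K) \<and> approx_in \<eta> (limit_set K) (K k)"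
    unfolding eventually_sequentially
  proof (intro exI[of _ "max (n\<^sub>0 + n) m0"] allI impI conjI)
    fix k assume k: "max (n\<^sub>0 + n) m0 \<le> k"
    show "approx_in \<eta> (K k) (limit_set K)"
      by (rule approx_in_mono[OF n _ KF]) (use k in auto)
    have "(1/2)^k \<le> (1/2::real)^m0" using k by (intro power_decreasing) auto
    then have "4 * (1/2)^k \<le> \<eta>" using m0 by linarith
    moreover have "limit_set K \<subseteq> F k" by (auto simp: limit_set_def F_def)
    ultimately show "approx_in \<eta> (limit_set K) (K k)"
      using approx_in_mono[OF FK[of k]] k by auto
  qed
qed

text \<open>Written with \<open>liminf\<close> because this exists for every sequence and preserves
  measurability, so that it carries measurability over to the limit set.\<close>

lemma liminf_pt_dist_Hausdorff:
  assumes "\<And>\<eta>. 0 < \<eta> \<Longrightarrow> \<forall>\<^sub>F k in sequentially. approx_in \<eta> (K k) L \<and> approx_in \<eta> L (K k)"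
  shows "liminf (\<lambda>k. pt_dist x (K k)) = pt_dist x L"
proof (rule antisym)
  have *: "\<forall>\<^sub>F k in sequentially. pt_dist x (K k) \<le> pt_dist x L + ennreal e \<and>
      pt_dist x L \<le> pt_dist x (K k) + ennreal e" if "0 < e" for e
    using assms[OF that] by eventually_elim (simp add: pt_dist_le_add semi_dist_le_of_approx_in)
  show "liminf (\<lambda>k. pt_dist x (K k)) \<le> pt_dist x L"
  proof (rule ennreal_le_epsilon)
    fix e :: real assume "0 < e"
    have "liminf (\<lambda>k. pt_dist x (K k)) \<le> liminf (\<lambda>k. pt_dist x L + ennreal e)"
      by (rule Liminf_mono) (use *[OF \<open>0 < e\<close>] in \<open>auto elim: eventually_mono\<close>)
    then show "liminf (\<lambda>k. pt_dist x (K k)) \<le> pt_dist x L + ennreal e"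
      by (simp add: Liminf_const)
  qed
  show "pt_dist x L \<le> liminf (\<lambda>k. pt_dist x (K k))"
  proof (rule ennreal_le_epsilon)
    fix e :: real assume "0 < e"
    have "pt_dist x L - ennreal e \<le> liminf (\<lambda>k. pt_dist x (K k))"
    proof (rule Liminf_bounded)
      show "\<forall>\<^sub>F k in sequentially. pt_dist x L - ennreal e \<le> pt_dist x (K k)"
        using *[OF \<open>0 < e\<close>] by eventually_elim (simp add: ennreal_minus_le_iff add.commute)
    qed
    then show "pt_dist x L \<le> liminf (\<lambda>k. pt_dist x (K k)) + ennreal e"
      by (simp add: ennreal_minus_le_iff add.commute)
  qed
qed

section \<open>Events of probability close to one\<close>

text \<open>Stated through a measurable exceptional event, since \<open>{\<omega> \<in> space M. \<not> Q \<omega>}\<close> need not be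
  measurable.\<close>

definition (in prob_space) whp :: "real \<Rightarrow> ('a \<Rightarrow> bool) \<Rightarrow> bool"
  where "whp \<epsilon> Q \<longleftrightarrow> (\<exists>E\<in>events. prob E \<le> \<epsilon> \<and> (\<forall>\<omega>\<in>space M - E. Q \<omega>))"

context prob_space
begin

lemma whp_mono:
  assumes "whp \<epsilon> Q" "\<epsilon> \<le> \<epsilon>'" "\<And>\<omega>. \<omega> \<in> space M \<Longrightarrow> Q \<omega> \<Longrightarrow> R \<omega>"
  shows "whp \<epsilon>' R"
  using assms unfolding whp_def by (meson Diff_iff order_trans)

lemma whp_conj:
  assumes "whp a Q" "whp b R"
  shows "whp (a + b) (\<lambda>\<omega>. Q \<omega> \<and> R \<omega>)"
proof -
  obtain E F where *: "E \<in> events" "prob E \<le> a" "\<forall>\<omega>\<in>space M - E. Q \<omega>"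
    "F \<in> events" "prob F \<le> b" "\<forall>\<omega>\<in>space M - F. R \<omega>"
    using assms unfolding whp_def by auto
  have "prob (E \<union> F) \<le> a + b"
    using measure_Un_le[of E M F] * by linarith
  then show ?thesis
    unfolding whp_def using * by (intro bexI[of _ "E \<union> F"]) auto
qed

text \<open>The exceptional events are intersected, and \<open>Q\<close> holds off any one of them;
  the intersection is therefore a null set outside of which \<open>Q\<close> holds.\<close>

lemma AE_of_whp:
  assumes "\<And>n. whp (1 / real (Suc n)) Q"
  shows "AE \<omega> in M. Q \<omega>"
proof -
  obtain E where E: "\<And>n. E n \<in> events" "\<And>n. prob (E n) \<le> 1 / real (Suc n)"
    "\<And>n \<omega>. \<omega> \<in> space M - E n \<Longrightarrow> Q \<omega>"
    using assms unfolding whp_def by metis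
  have "prob (\<Inter>n. E n) \<le> 1 / real (Suc n)" for n
  proof -
    have "prob (\<Inter>n. E n) \<le> prob (E n)" using E(1) by (intro finite_measure_mono) auto
    then show ?thesis using E(2)[of n] by linarith
  qed
  then have "prob (\<Inter>n. E n) \<le> 0"
    by (intro LIMSEQ_le_const[OF LIMSEQ_Suc[OF lim_1_over_n]]) auto
  then have "(\<Inter>n. E n) \<in> null_sets M"
    using E(1) by (intro null_setsI) (auto simp: emeasure_eq_measure measure_nonneg antisym)
  then show ?thesis
    by (rule AE_I') (use E(3) in blast)
qed

lemma whp_of_prob:
  assumes "{\<omega> \<in> space M. Q \<omega>} \<in> events" "1 - \<epsilon> \<le> \<P>(\<omega> in M. Q \<omega>)"
  shows "whp \<epsilon> Q"
  unfolding whp_def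
  using assms prob_compl[OF assms(1)]
  by (intro bexI[of _ "space M - {\<omega> \<in> space M. Q \<omega>}"]) auto

lemma prob_of_whp:
  assumes "{\<omega> \<in> space M. Q \<omega>} \<in> events" "whp \<epsilon> Q"
  shows "1 - \<epsilon> \<le> \<P>(\<omega> in M. Q \<omega>)"
proof -
  obtain E where E: "E \<in> events" "prob E \<le> \<epsilon>" "\<forall>\<omega>\<in>space M - E. Q \<omega>"
    using assms(2) unfolding whp_def by auto
  have "1 - prob E = prob (space M - E)" using E(1) prob_compl by simp
  also have "\<dots> \<le> \<P>(\<omega> in M. Q \<omega>)"
    using E assms(1) by (intro finite_measure_mono) auto
  finally show ?thesis using E(2) by linarith
qed

lemma prob_le_of_whp_not:
  assumes "whp \<epsilon> (\<lambda>\<omega>. \<not> Q \<omega>)"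
  shows "\<P>(\<omega> in M. Q \<omega>) \<le> \<epsilon>"
proof -
  obtain E where E: "E \<in> events" "prob E \<le> \<epsilon>" "\<forall>\<omega>\<in>space M - E. \<not> Q \<omega>"
    using assms unfolding whp_def by auto
  have "\<P>(\<omega> in M. Q \<omega>) \<le> prob E"
    using E by (intro finite_measure_mono) auto
  then show ?thesis using E(2) by linarith
qed

text \<open>Almost sure convergence implies convergence in probability: the events that
  \<open>Q k\<close> holds for all \<open>k \<ge> n\<close> increase to an event of full
  measure.\<close>

lemma whp_eventually:
  assumes meas: "\<And>n. {\<omega> \<in> space M. Q n \<omega>} \<in> events"
    and ev: "AE \<omega> in M. \<forall>\<^sub>F n in sequentially. Q n \<omega>" and "0 < \<epsilon>"
  shows "\<forall>\<^sub>F n in sequentially. whp \<epsilon> (Q n)"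
proof -
  define G where "G n = {\<omega> \<in> space M. \<forall>k\<ge>n. Q k \<omega>}" for n
  have "G n = (\<Inter>k\<in>{n..}. {\<omega> \<in> space M. Q k \<omega>})" for n
    by (auto simp: G_def)
  then have G: "G n \<in> events" for n using meas by (auto intro!: sets.countable_INT'')
  have "incseq G" by (auto simp: G_def incseq_def)
  then have "(\<lambda>n. prob (G n)) \<longlonglongrightarrow> prob (\<Union>n. G n)"
    using G by (intro finite_Lim_measure_incseq) auto
  also have "prob (\<Union>n. G n) = 1"
  proof (rule prob_eq_1[THEN iffD2])
    show "(\<Union>n. G n) \<in> events" using G by auto
    show "AE \<omega> in M. \<omega> \<in> (\<Union>n. G n)"
      using ev by (auto simp: G_def eventually_sequentially)
  qed
  finally have "\<forall>\<^sub>F n in sequentially. 1 - \<epsilon> < prob (G n)"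
    using \<open>0 < \<epsilon>\<close> by (intro order_tendstoD) auto
  then show ?thesis
  proof eventually_elim
    case (elim n)
    show ?case
    proof (rule whp_mono[OF whp_of_prob[where \<epsilon> = \<epsilon> and Q = "\<lambda>\<omega>. \<omega> \<in> G n"]])
      have "{\<omega> \<in> space M. \<omega> \<in> G n} = G n" by (auto simp: G_def)
      then show "{\<omega> \<in> space M. \<omega> \<in> G n} \<in> events" "1 - \<epsilon> \<le> prob {\<omega> \<in> space M. \<omega> \<in> G n}"
        using G elim by auto
    qed (auto simp: G_def)
  qed
qed

text \<open>Borel-Cantelli, applied to the exceptional events.\<close>

lemma AE_eventually_of_whp_summable:
  assumes "\<And>n. whp (e n) (Q n)" "summable e"
  shows "AE \<omega> in M. \<forall>\<^sub>F n in sequentially. Q n \<omega>"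
proof -
  obtain E where E: "\<And>n. E n \<in> events" "\<And>n. prob (E n) \<le> e n"
    "\<And>n \<omega>. \<omega> \<in> space M - E n \<Longrightarrow> Q n \<omega>"
    using assms(1) unfolding whp_def by metis
  have "AE \<omega> in M. \<forall>\<^sub>F n in sequentially. \<omega> \<in> space M - E n"
  proof (rule borel_cantelli_AE1[OF E(1)])
    show "summable (\<lambda>n. prob (E n))"
      by (rule summable_comparison_test'[OF assms(2), of 0]) (use E(2) in auto)
  qed (simp add: emeasure_eq_measure)
  then show ?thesis
    by (rule AE_mp) (auto elim!: eventually_mono intro!: AE_I2 E(3))
qed

section \<open>Compact random sets\<close>

lemma compact_random_setD:
  assumes "compact_random_set M A"
  shows "\<And>\<omega>. \<omega> \<in> space M \<Longrightarrow> compact (A \<omega>)"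
    and "\<And>x. (\<lambda>\<omega>. pt_dist x (A \<omega>)) \<in> borel_measurable M"
    and "AE \<omega> in M. A \<omega> \<noteq> {}"
  using assms by (auto simp: compact_random_set_def)

text \<open>Inclusion fails exactly when \<open>A \<omega>\<close> meets the open complement of
  \<open>F\<close>, hence one of countably many small balls avoiding \<open>F\<close> with centres
  in \<open>D\<close>; meeting such a ball is a strict inequality for
  \<open>pt_dist\<close>.\<close>

lemma sets_random_set_subset_closed:
  fixes A :: "'a \<Rightarrow> 'e::{metric_space, second_countable_topology} set"
  assumes [measurable]: "\<And>x. (\<lambda>\<omega>. pt_dist x (A \<omega>)) \<in> borel_measurable M" and "closed F"
  shows "{\<omega> \<in> space M. A \<omega> \<subseteq> F} \<in> events"
proof -
  obtain D :: "'e set" where D: "countable D" "closure D = UNIV" by (rule dense_setE)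
  define P where "P = {(x, n). x \<in> D \<and> ball x (1 / real (Suc n)) \<inter> F = {}}"
  have P: "countable P"
    by (rule countable_subset[of _ "D \<times> UNIV"]) (use D(1) in \<open>auto simp: P_def\<close>)
  have "A \<omega> \<subseteq> F \<longleftrightarrow> (\<forall>p\<in>P. \<not> pt_dist (fst p) (A \<omega>) < ennreal (1 / real (Suc (snd p))))" for \<omega>
  proof
    assume "A \<omega> \<subseteq> F"
    then show "\<forall>p\<in>P. \<not> pt_dist (fst p) (A \<omega>) < ennreal (1 / real (Suc (snd p)))"
      unfolding pt_dist_less_iff P_def by fastforce
  next
    assume *: "\<forall>p\<in>P. \<not> pt_dist (fst p) (A \<omega>) < ennreal (1 / real (Suc (snd p)))"
    show "A \<omega> \<subseteq> F"
    proof (rule ccontr)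
      assume "\<not> A \<omega> \<subseteq> F"
      then obtain a where a: "a \<in> A \<omega>" "a \<in> - F" by auto
      then obtain e where e: "0 < e" "ball a e \<subseteq> - F"
        using \<open>closed F\<close> by (meson open_Compl open_contains_ball)
      obtain n where n: "1 / real (Suc n) < e/2" using nat_approx_posE[of "e/2"] e by auto
      obtain x where x: "x \<in> D" "dist x a < 1 / real (Suc n)"
        using dense_approachable[OF D(2), of "1 / real (Suc n)" a] by auto
      have "ball x (1 / real (Suc n)) \<subseteq> ball a e"
      proof
        fix y assume "y \<in> ball x (1 / real (Suc n))"
        then show "y \<in> ball a e"
          using x(2) n dist_triangle[of a y x] by (simp add: dist_commute)
      qed
      then have "(x, n) \<in> P" using x(1) e(2) by (auto simp: P_def)
      then show False using * a(1) x(2) by (force simp: pt_dist_less_iff)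
    qed
  qed
  then have "{\<omega> \<in> space M. A \<omega> \<subseteq> F} =
      {\<omega> \<in> space M. \<forall>p\<in>P. \<not> pt_dist (fst p) (A \<omega>) < ennreal (1 / real (Suc (snd p)))}"
    by auto
  also have "\<dots> \<in> events" using P by measurable
  finally show ?thesis .
qed

text \<open>Ulam's argument: at each scale finitely many balls contain \<open>A \<omega>\<close> up
  to a small probability, and the intersection over all scales is closed and totally
  bounded.\<close>

lemma compact_random_set_tight:
  fixes A :: "'a \<Rightarrow> 'e::polish_space set"
  assumes A: "compact_random_set M A" and "0 < \<epsilon>"
  obtains C where "compact C" "whp \<epsilon> (\<lambda>\<omega>. A \<omega> \<subseteq> C)"
proof -
  obtain D :: "'e set" where D: "countable D" "closure D = UNIV" by (rule dense_setE)
  have "D \<noteq> {}" using D(2) by auto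
  define d where "d = from_nat_into D"
  have d: "range d = D" unfolding d_def using D(1) \<open>D \<noteq> {}\<close> by (simp add: range_from_nat_into)
  \<comment> \<open>Closed balls make \<open>U n N\<close> closed, as needed for the measurability
    of the inclusion event and for closedness of \<open>C\<close>; open balls enter only to extract
    a finite subcover.\<close>
  define U where "U n N = (\<Union>i\<le>N. cball (d i) (1 / real (Suc n)))" for n N :: nat
  have clU: "closed (U n N)" for n N unfolding U_def by auto
  have "\<exists>N. whp (\<epsilon> * (1/2) ^ Suc n) (\<lambda>\<omega>. A \<omega> \<subseteq> U n N)" for n
  proof -
    have "\<forall>\<^sub>F N in sequentially. whp (\<epsilon> * (1/2) ^ Suc n) (\<lambda>\<omega>. A \<omega> \<subseteq> U n N)"
    proof (rule whp_eventually)
      show "{\<omega> \<in> space M. A \<omega> \<subseteq> U n N} \<in> events" for N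
        by (intro sets_random_set_subset_closed compact_random_setD(2)[OF A] clU)
      show "AE \<omega> in M. \<forall>\<^sub>F N in sequentially. A \<omega> \<subseteq> U n N"
      proof (rule AE_I2)
        fix \<omega> assume "\<omega> \<in> space M"
        then have c: "compact (A \<omega>)" by (rule compact_random_setD(1)[OF A])
        have "A \<omega> \<subseteq> (\<Union>i\<in>UNIV. ball (d i) (1 / real (Suc n)))"
        proof
          fix y
          obtain x where "x \<in> D" "dist x y < 1 / real (Suc n)"
            using dense_approachable[OF D(2), of "1 / real (Suc n)" y] by auto
          then obtain i where "dist (d i) y < 1 / real (Suc n)" using d by blast
          then show "y \<in> (\<Union>i\<in>UNIV. ball (d i) (1 / real (Suc n)))" by auto
        qed
        then obtain I where I: "finite I" "A \<omega> \<subseteq> (\<Union>i\<in>I. ball (d i) (1 / real (Suc n)))"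
          by (rule compactE_image[OF c open_ball])
        then obtain m where m: "\<forall>i\<in>I. i \<le> m" using finite_nat_set_iff_bounded_le by auto
        have "A \<omega> \<subseteq> U n N" if "m \<le> N" for N
        proof
          fix y assume "y \<in> A \<omega>"
          then obtain i where "i \<in> I" "dist (d i) y < 1 / real (Suc n)" using I(2) by auto
          moreover from this m that have "i \<le> N" by (meson order_trans)
          ultimately show "y \<in> U n N" unfolding U_def by (intro UN_I[of i]) auto
        qed
        then show "\<forall>\<^sub>F N in sequentially. A \<omega> \<subseteq> U n N"
          by (auto simp: eventually_sequentially)
      qed
    qed (use \<open>0 < \<epsilon>\<close> in auto)
    then show ?thesis by (auto simp: eventually_sequentially)
  qed
  then obtain N where N: "\<And>n. whp (\<epsilon> * (1/2) ^ Suc n) (\<lambda>\<omega>. A \<omega> \<subseteq> U n (N n))" by metis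
  then obtain E where E: "\<And>n. E n \<in> events" "\<And>n. prob (E n) \<le> \<epsilon> * (1/2) ^ Suc n"
    "\<And>n \<omega>. \<omega> \<in> space M - E n \<Longrightarrow> A \<omega> \<subseteq> U n (N n)"
    unfolding whp_def by metis
  \<comment> \<open>The allowances at the individual scales add up to exactly \<epsilon>.\<close>
  have sums: "(\<lambda>n. \<epsilon> * (1/2) ^ Suc n) sums (\<epsilon> * 1)"
    by (intro sums_mult power_half_series)
  have summ: "summable (\<lambda>n. prob (E n))"
    by (rule summable_comparison_test'[OF sums_summable[OF sums], of 0]) (use E(2) in auto)
  have "prob (\<Union>n. E n) \<le> (\<Sum>n. prob (E n))"
    using E(1) summ by (intro finite_measure_subadditive_countably) auto
  also have "\<dots> \<le> \<epsilon>"
    using suminf_le[OF E(2) summ sums_summable[OF sums]] sums_unique[OF sums] by simp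
  finally have le: "prob (\<Union>n. E n) \<le> \<epsilon>" .
  define C where "C = (\<Inter>n. U n (N n))"
  have "compact C"
  proof (rule compact_of_totally_bounded)
    show "closed C" unfolding C_def using clU by auto
    fix e :: real assume "0 < e"
    then obtain n where n: "1 / real (Suc n) < e" using nat_approx_posE by auto
    have "C \<subseteq> U n (N n)" unfolding C_def by auto
    also have "\<dots> \<subseteq> (\<Union>x\<in>d ` {..N n}. ball x e)" 
    proof
      fix y assume "y \<in> U n (N n)"
      then obtain i where "i \<le> N n" "dist (d i) y \<le> 1 / real (Suc n)" by (auto simp: U_def)
      then show "y \<in> (\<Union>x\<in>d ` {..N n}. ball x e)" using n by (intro UN_I[of "d i"]) auto
    qed
    finally show "\<exists>X. finite X \<and> C \<subseteq> (\<Union>x\<in>X. ball x e)" by blast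
  qed
  moreover have "whp \<epsilon> (\<lambda>\<omega>. A \<omega> \<subseteq> C)"
    unfolding whp_def
  proof (intro bexI[of _ "\<Union>n. E n"] conjI ballI)
    fix \<omega> assume "\<omega> \<in> space M - (\<Union>n. E n)"
    then show "A \<omega> \<subseteq> C" unfolding C_def using E(3) by blast
  qed (use le E(1) in auto)
  ultimately show thesis by (rule that)
qed

end

section \<open>Pullback images\<close>

context metric_dynamical_system
begin

lemma measurable_theta [measurable]: "\<theta> t \<in> M \<rightarrow>\<^sub>M M"
proof -
  have "(\<lambda>\<omega>. (\<omega>, t)) \<in> M \<rightarrow>\<^sub>M M \<Otimes>\<^sub>M borel" by measurable
  from measurable_compose[OF this measurable_flow] show ?thesis by simp
qed

lemma theta_space: "\<omega> \<in> space M \<Longrightarrow> \<theta> t \<omega> \<in> space M"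
  using measurable_theta by (rule measurable_space)

lemma theta_cancel:
  assumes "\<omega> \<in> space M"
  shows "\<theta> (- t) (\<theta> t \<omega>) = \<omega>" "\<theta> t (\<theta> (- t) \<omega>) = \<omega>"
  using flow_add[OF assms, of "- t" t] flow_add[OF assms, of t "- t"] flow_zero[OF assms] by auto

lemma prob_theta:
  assumes "{\<omega> \<in> space M. Q \<omega>} \<in> events"
  shows "\<P>(\<omega> in M. Q (\<theta> t \<omega>)) = \<P>(\<omega> in M. Q \<omega>)"
proof -
  have "\<P>(\<omega> in M. Q \<omega>) = measure (distr M M (\<theta> t)) {\<omega> \<in> space M. Q \<omega>}"
    by (simp add: flow_preserving)
  also have "\<dots> = prob (\<theta> t -` {\<omega> \<in> space M. Q \<omega>} \<inter> space M)"
    using assms by (intro measure_distr) auto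
  also have "\<theta> t -` {\<omega> \<in> space M. Q \<omega>} \<inter> space M = {\<omega> \<in> space M. Q (\<theta> t \<omega>)}"
    using theta_space by auto
  finally show ?thesis by simp
qed

text \<open>The preimage of the exceptional event under the flow has the same probability. This
  moves every estimate freely between forward and pullback form.\<close>

lemma whp_theta:
  assumes "whp \<epsilon> Q"
  shows "whp \<epsilon> (\<lambda>\<omega>. Q (\<theta> t \<omega>))"
proof -
  obtain E where E: "E \<in> events" "prob E \<le> \<epsilon>" "\<forall>\<omega>\<in>space M - E. Q \<omega>"
    using assms unfolding whp_def by auto
  have eq: "{\<omega> \<in> space M. \<omega> \<in> E} = E" using sets.sets_into_space[OF E(1)] by auto
  have ev: "{\<omega> \<in> space M. \<theta> t \<omega> \<in> E} \<in> events" using E(1) by measurable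
  have "\<P>(\<omega> in M. \<theta> t \<omega> \<in> E) = prob E"
    using prob_theta[of "\<lambda>\<omega>. \<omega> \<in> E" t] E(1) eq by simp
  then show ?thesis
    unfolding whp_def using E ev theta_space by (intro bexI[OF _ ev]) auto
qed

end

text \<open>The position at time 0 of the points that start in \<open>B\<close> at time
  \<open>-t\<close>.\<close>

definition (in random_dynamical_system) pullback :: "real \<Rightarrow> 'e set \<Rightarrow> 'w \<Rightarrow> 'e set"
  where "pullback t B \<omega> = \<phi> t (\<theta> (- t) \<omega>) ` B"

context continuous_rds
begin

lemma measurable_phi:
  assumes "0 \<le> t"
  shows "(\<lambda>\<omega>. \<phi> t \<omega> x) \<in> borel_measurable M"
proof -
  have "(\<lambda>\<omega>. (t, x, \<omega>)) \<in> M \<rightarrow>\<^sub>M restrict_space borel {0..} \<Otimes>\<^sub>M (borel \<Otimes>\<^sub>M M)"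
    using assms by (intro measurable_Pair measurable_const measurable_ident_sets)
      (auto simp: space_restrict_space)
  from measurable_compose[OF this measurable_rds] show ?thesis by simp
qed

lemma pullback_theta: "\<omega> \<in> space M \<Longrightarrow> pullback t B (\<theta> t \<omega>) = \<phi> t \<omega> ` B"
  by (simp add: pullback_def theta_cancel)

text \<open>Seen from \<open>\<theta> t \<omega>\<close>, the starting time \<open>-s\<close> over
  \<omega> is \<open>-(t + s)\<close>. This is what relates the image of a limit of pullbacks to a
  limit of pullbacks at the shifted point.\<close>

lemma image_pullback:
  assumes "\<omega> \<in> space M" "0 \<le> s" "0 \<le> t"
  shows "\<phi> t \<omega> ` pullback s B \<omega> = pullback (t + s) B (\<theta> t \<omega>)"
proof -
  have "\<theta> (- (t + s)) (\<theta> t \<omega>) = \<theta> (- s) \<omega>"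
    using flow_add[OF assms(1), of "- (t + s)" t] by simp
  moreover have "\<phi> (t + s) (\<theta> (- s) \<omega>) = \<phi> t \<omega> \<circ> \<phi> s (\<theta> (- s) \<omega>)"
    using rds_cocycle[OF theta_space[OF assms(1)] assms(2,3)] by (simp add: theta_cancel assms(1))
  ultimately show ?thesis by (simp add: pullback_def image_comp)
qed

lemma pullback_add:
  assumes "\<omega> \<in> space M" "0 \<le> s" "0 \<le> u"
  shows "pullback (s + u) B \<omega> = \<phi> s (\<theta> (- s) \<omega>) ` pullback u B (\<theta> (- s) \<omega>)"
  using image_pullback[OF theta_space[OF assms(1)] assms(3,2)] by (simp add: theta_cancel assms(1))

lemma compact_pullback:
  assumes "\<omega> \<in> space M" "0 \<le> t" "compact C"
  shows "compact (pullback t C \<omega>)"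
  unfolding pullback_def
  using continuous_rds[OF theta_space[OF assms(1)] assms(2)] assms(3)
  by (intro compact_continuous_image) (auto intro: continuous_on_subset)

section \<open>Measurability of images and pullbacks\<close>

lemma borel_measurable_pt_dist_image:
  assumes "0 \<le> t"
  shows "(\<lambda>\<omega>. pt_dist x (\<phi> t \<omega> ` B)) \<in> borel_measurable M"
proof -
  obtain D where D: "countable D" "D \<subseteq> B" "B \<subseteq> closure D" by (rule separable)
  note [measurable] = measurable_phi[OF assms]
  have "pt_dist x (\<phi> t \<omega> ` B) = (INF b\<in>D. ennreal (dist x (\<phi> t \<omega> b)))"
    if "\<omega> \<in> space M" for \<omega>
    by (subst pt_dist_image_dense[OF continuous_rds[OF that assms] D(2,3)])
       (simp add: pt_dist_def image_comp)
  moreover have "(\<lambda>\<omega>. INF b\<in>D. ennreal (dist x (\<phi> t \<omega> b))) \<in> borel_measurable M"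
    using D(1) by measurable
  ultimately show ?thesis by (subst measurable_cong)
qed

lemma borel_measurable_pt_dist_pullback:
  "0 \<le> t \<Longrightarrow> (\<lambda>\<omega>. pt_dist x (pullback t B \<omega>)) \<in> borel_measurable M"
  unfolding pullback_def
  using measurable_compose[OF measurable_theta borel_measurable_pt_dist_image] .

lemma borel_measurable_semi_dist_pullback:
  assumes "compact_random_set M A" "0 \<le> t"
  shows "(\<lambda>\<omega>. semi_dist (pullback t B \<omega>) (A \<omega>)) \<in> borel_measurable M"
  by (intro borel_measurable_semi_dist borel_measurable_pt_dist_pullback
      compact_random_setD(2)[OF assms(1)] assms(2))

lemma sets_image_subset_closed_nbhd:
  assumes "0 \<le> t"
  shows "{\<omega> \<in> space M. \<phi> t \<omega> ` B \<subseteq> closed_nbhd C \<delta>} \<in> events"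
proof -
  have [measurable]: "(\<lambda>\<omega>. semi_dist (\<phi> t \<omega> ` B) C) \<in> borel_measurable M"
    by (intro borel_measurable_semi_dist borel_measurable_pt_dist_image assms) simp
  show ?thesis unfolding subset_closed_nbhd_iff by measurable
qed

section \<open>Uniform continuity and absorption with high probability\<close>

text \<open>Each \<omega> has its own modulus of continuity near \<open>C\<close>; giving up
  probability \<epsilon> makes it deterministic. Restricting to countable dense sets keeps the
  events \<open>Q n\<close> measurable.\<close>

lemma whp_uniformly_continuous:
  assumes "compact C" "0 \<le> t" "0 < \<eta>" "0 < \<epsilon>"
  obtains \<delta> where "0 < \<delta>"
    "whp \<epsilon> (\<lambda>\<omega>. \<forall>x\<in>C. \<forall>y. dist x y < \<delta> \<longrightarrow> dist (\<phi> t \<omega> x) (\<phi> t \<omega> y) \<le> \<eta>)"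
proof -
  obtain D where D: "countable D" "D \<subseteq> C" "C \<subseteq> closure D" by (rule separable)
  obtain D' :: "'e set" where D': "countable D'" "closure D' = UNIV" by (rule dense_setE)
  note [measurable] = D(1) D'(1) measurable_phi[OF assms(2)]
  define Q where "Q n \<omega> \<longleftrightarrow> (\<forall>x\<in>D. \<forall>y\<in>D'. dist x y < 1 / real (Suc n) \<longrightarrow>
      dist (\<phi> t \<omega> x) (\<phi> t \<omega> y) \<le> \<eta>)" for n \<omega>
  have "\<forall>\<^sub>F n in sequentially. whp \<epsilon> (Q n)"
  proof (rule whp_eventually)
    show "{\<omega> \<in> space M. Q n \<omega>} \<in> events" for n unfolding Q_def by measurable
    show "AE \<omega> in M. \<forall>\<^sub>F n in sequentially. Q n \<omega>"
    proof (rule AE_I2)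
      fix \<omega> assume "\<omega> \<in> space M"
      then obtain d where d: "0 < d"
        "\<And>x y. x \<in> C \<Longrightarrow> dist x y < d \<Longrightarrow> dist (\<phi> t \<omega> x) (\<phi> t \<omega> y) < \<eta>"
        using continuous_uniform_near_compact[OF assms(1) continuous_rds assms(3)] assms(2) by blast
      have "\<forall>\<^sub>F n in sequentially. 1 / real (Suc n) < d"
        using LIMSEQ_Suc[OF lim_1_over_n] d(1) by (rule order_tendstoD)
      then show "\<forall>\<^sub>F n in sequentially. Q n \<omega>"
      proof eventually_elim
        case (elim n)
        then show ?case unfolding Q_def using d(2) D(2) by (meson less_imp_le order_less_trans subsetD)
      qed
    qed
  qed fact
  then obtain n where n: "whp \<epsilon> (Q n)" by (auto simp: eventually_sequentially)
  show thesis
  proof (rule that[of "1 / real (Suc n)"])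
    show "whp \<epsilon> (\<lambda>\<omega>. \<forall>x\<in>C. \<forall>y. dist x y < 1 / real (Suc n) \<longrightarrow> dist (\<phi> t \<omega> x) (\<phi> t \<omega> y) \<le> \<eta>)"
    proof (rule whp_mono[OF n order_refl], intro ballI allI impI, rule ccontr)
      fix \<omega> x y assume \<omega>: "\<omega> \<in> space M" and Q: "Q n \<omega>" and x: "x \<in> C"
        and xy: "dist x y < 1 / real (Suc n)" and neg: "\<not> dist (\<phi> t \<omega> x) (\<phi> t \<omega> y) \<le> \<eta>"
      \<comment> \<open>The pairs violating the bound form an open set, so a violation at
        \<open>(x, y)\<close> would produce one in \<open>D \<times> D'\<close>. This is why
        \<open>Q\<close> uses a non-strict bound.\<close>
      define W where "W = {p. dist (fst p) (snd p) < 1 / real (Suc n)} \<inter>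
        {p. \<eta> < dist (\<phi> t \<omega> (fst p)) (\<phi> t \<omega> (snd p))}"
      have cont: "continuous_on UNIV (\<phi> t \<omega>)" by (rule continuous_rds[OF \<omega> assms(2)])
      have "open W"
        unfolding W_def
        by (intro open_Int open_Collect_less continuous_intros
            continuous_on_compose2[OF cont] subset_UNIV)
      moreover have "(x, y) \<in> W" using xy neg by (simp add: W_def)
      ultimately obtain U V where UV: "open U" "open V" "x \<in> U" "y \<in> V" "U \<times> V \<subseteq> W"
        by (rule open_prod_elim) auto
      obtain x' where x': "x' \<in> D" "x' \<in> U"
        using UV(1,3) x D(3) open_Int_closure_eq_empty[of U D] by blast
      obtain y' where y': "y' \<in> D'" "y' \<in> V"
        using UV(2,4) D'(2) open_Int_closure_eq_empty[of V D'] by blast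
      have "(x', y') \<in> W" using UV(5) x' y' by blast
      then show False using Q x'(1) y'(1) unfolding Q_def W_def by (fastforce simp: not_less)
    qed
  qed simp
qed

text \<open>Distances are symmetric, so it is enough that one of the two sets lies in
  \<open>C\<close>. Either case occurs later, when closeness to a set and closeness of that set to
  others are both pushed forward.\<close>

lemma whp_image_approx_in:
  assumes "compact C" "0 \<le> t" "0 < \<eta>" "0 < \<epsilon>"
  obtains \<delta> where "0 < \<delta>"
    "whp \<epsilon> (\<lambda>\<omega>. \<forall>S T. S \<subseteq> C \<or> T \<subseteq> C \<longrightarrow> approx_in \<delta> S T \<longrightarrow> approx_in \<eta> (\<phi> t \<omega> ` S) (\<phi> t \<omega> ` T))"
proof -
  obtain \<delta> where \<delta>: "0 < \<delta>"
    "whp \<epsilon> (\<lambda>\<omega>. \<forall>x\<in>C. \<forall>y. dist x y < \<delta> \<longrightarrow> dist (\<phi> t \<omega> x) (\<phi> t \<omega> y) \<le> \<eta>/2)"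
    using whp_uniformly_continuous[OF assms(1,2) half_gt_zero[OF assms(3)] assms(4)] by blast
  show thesis
  proof (rule that[OF \<delta>(1)], rule whp_mono[OF \<delta>(2) order_refl], intro allI impI)
    fix \<omega> S T
    assume *: "\<forall>x\<in>C. \<forall>y. dist x y < \<delta> \<longrightarrow> dist (\<phi> t \<omega> x) (\<phi> t \<omega> y) \<le> \<eta>/2"
      and C: "S \<subseteq> C \<or> T \<subseteq> C" and ST: "approx_in \<delta> S T"
    have "\<exists>y\<in>T. dist (\<phi> t \<omega> x) (\<phi> t \<omega> y) < \<eta>" if x: "x \<in> S" for x
    proof -
      obtain y where y: "y \<in> T" "dist x y < \<delta>" using ST x by (auto simp: approx_in_def)
      then have "dist (\<phi> t \<omega> x) (\<phi> t \<omega> y) \<le> \<eta>/2"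
        using * C x by (metis dist_commute subsetD)
      then show ?thesis using y(1) assms(3) by (intro bexI[of _ y]) auto
    qed
    then show "approx_in \<eta> (\<phi> t \<omega> ` S) (\<phi> t \<omega> ` T)" by (auto simp: approx_in_def)
  qed
qed

text \<open>The run from \<open>-(s + u)\<close> to 0 is cut at \<open>-s\<close>: the first piece
  brings \<open>B\<close> close to \<open>C\<close>, and continuity of the second preserves
  closeness. The choice of \<delta> precedes that of \<open>u\<close>, \<open>B\<close> and
  \<open>e\<close>.\<close>

lemma pullback_absorbed:
  assumes "compact C" "0 \<le> s" "0 < \<eta>"
  obtains \<delta> where "0 < \<delta>"
    "\<And>u B e. 0 \<le> u \<Longrightarrow> whp e (\<lambda>\<omega>. approx_in \<delta> (\<phi> u \<omega> ` B) C) \<Longrightarrow>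
      whp (e + \<eta>) (\<lambda>\<omega>. approx_in \<eta> (pullback (s + u) B \<omega>) (pullback s C \<omega>))"
proof -
  obtain \<delta> where \<delta>: "0 < \<delta>"
    "whp \<eta> (\<lambda>\<omega>. \<forall>S T. S \<subseteq> C \<or> T \<subseteq> C \<longrightarrow> approx_in \<delta> S T \<longrightarrow> approx_in \<eta> (\<phi> s \<omega> ` S) (\<phi> s \<omega> ` T))"
    using whp_image_approx_in[OF assms(1,2,3,3)] by blast
  show thesis
  proof (rule that[OF \<delta>(1)])
    fix u e B assume u: "0 \<le> u" and "whp e (\<lambda>\<omega>. approx_in \<delta> (\<phi> u \<omega> ` B) C)"
    then have "whp e (\<lambda>\<omega>. approx_in \<delta> (pullback u B \<omega>) C)"
      unfolding pullback_def by (intro whp_theta[where Q = "\<lambda>\<omega>. approx_in \<delta> (\<phi> u \<omega> ` B) C"])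
    from whp_conj[OF this \<delta>(2)]
    have "whp (e + \<eta>) (\<lambda>\<omega>. approx_in \<eta> (\<phi> s \<omega> ` pullback u B \<omega>) (\<phi> s \<omega> ` C))"
      by (rule whp_mono) auto
    from whp_theta[OF this, of "- s"]
    show "whp (e + \<eta>) (\<lambda>\<omega>. approx_in \<eta> (pullback (s + u) B \<omega>) (pullback s C \<omega>))"
      by (rule whp_mono) (simp_all add: pullback_add[OF _ assms(2) u] pullback_def[of s C])
  qed
qed

end

context continuous_rds
begin

section \<open>From attraction to tightness\<close>

text \<open>At each fixed \<open>t \<ge> 0\<close> the forward and the pullback distance differ by
  composition with \<open>\<theta> t\<close>, so they have the same law.\<close>

lemma weakly_attracts_of_weak_B_attractor:
  assumes A: "weak_B_attractor M \<theta> \<phi> A" and "bounded B"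
  shows "weakly_attracts M \<theta> \<phi> A B"
  unfolding weakly_attracts_def tendsto_zero_in_prob_def
proof (intro allI impI)
  fix \<epsilon> :: real assume "0 < \<epsilon>"
  have rs: "compact_random_set M A" using A by (simp add: weak_B_attractor_def)
  have "((\<lambda>t. \<P>(\<omega> in M. (SUP x\<in>B. pt_dist (\<phi> t \<omega> x) (A (\<theta> t \<omega>))) > ennreal \<epsilon>)) \<longlongrightarrow> 0) at_top"
    using A \<open>bounded B\<close> \<open>0 < \<epsilon>\<close> by (simp add: weak_B_attractor_def tendsto_zero_in_prob_def)
  moreover have "\<forall>\<^sub>F t in at_top. \<P>(\<omega> in M. (SUP x\<in>B. pt_dist (\<phi> t \<omega> x) (A (\<theta> t \<omega>))) > ennreal \<epsilon>) =
      \<P>(\<omega> in M. semi_dist (\<phi> t (\<theta> (- t) \<omega>) ` B) (A \<omega>) > ennreal \<epsilon>)"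
    using eventually_ge_at_top[of "0::real"]
  proof eventually_elim
    case (elim t)
    note [measurable] = borel_measurable_semi_dist_pullback[OF rs elim, of B]
    have "\<P>(\<omega> in M. (SUP x\<in>B. pt_dist (\<phi> t \<omega> x) (A (\<theta> t \<omega>))) > ennreal \<epsilon>) =
      \<P>(\<omega> in M. semi_dist (pullback t B (\<theta> t \<omega>)) (A (\<theta> t \<omega>)) > ennreal \<epsilon>)"
      by (intro arg_cong[where f = prob] Collect_cong conj_cong refl)
         (simp add: pullback_theta semi_dist_def image_comp)
    also have "\<dots> = \<P>(\<omega> in M. semi_dist (pullback t B \<omega>) (A \<omega>) > ennreal \<epsilon>)"
      by (rule prob_theta) measurable
    finally show ?case by (simp add: pullback_def)
  qed
  ultimately show "((\<lambda>t. \<P>(\<omega> in M. semi_dist (\<phi> t (\<theta> (- t) \<omega>) ` B) (A \<omega>) > ennreal \<epsilon>)) \<longlongrightarrow> 0) at_top"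
    by (rule Lim_transform_eventually)
qed

text \<open>Half of \<epsilon> pays for \<open>K \<omega>\<close> leaving a fixed compact
  \<open>C\<close>, the other half for the pullback image being far from \<open>K \<omega>\<close>;
  invariance of the measure then gives the forward statement.\<close>

lemma attracting_imp_tight:
  assumes K: "compact_random_set M K" and att: "\<And>B. bounded B \<Longrightarrow> weakly_attracts M \<theta> \<phi> K B"
    and "0 < \<epsilon>"
  shows "\<exists>C. compact C \<and> (\<forall>\<delta> B. 0 < \<delta> \<longrightarrow> bounded B \<longrightarrow>
    (\<exists>t\<^sub>0>0. \<forall>t\<ge>t\<^sub>0. 1 - \<epsilon> \<le> \<P>(\<omega> in M. \<phi> t \<omega> ` B \<subseteq> closed_nbhd C \<delta>)))"
proof -
  obtain C where C: "compact C" "whp (\<epsilon>/2) (\<lambda>\<omega>. K \<omega> \<subseteq> C)"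
    using compact_random_set_tight[OF K half_gt_zero[OF \<open>0 < \<epsilon>\<close>]] by blast
  have "\<exists>t\<^sub>0>0. \<forall>t\<ge>t\<^sub>0. 1 - \<epsilon> \<le> \<P>(\<omega> in M. \<phi> t \<omega> ` B \<subseteq> closed_nbhd C \<delta>)"
    if "0 < \<delta>" "bounded B" for \<delta> B
  proof -
    have "((\<lambda>t. \<P>(\<omega> in M. semi_dist (pullback t B \<omega>) (K \<omega>) > ennreal (\<delta>/2))) \<longlongrightarrow> 0) at_top"
      using att[OF \<open>bounded B\<close>] \<open>0 < \<delta>\<close>
      unfolding weakly_attracts_def tendsto_zero_in_prob_def pullback_def by simp
    then have "\<forall>\<^sub>F t in at_top. \<P>(\<omega> in M. semi_dist (pullback t B \<omega>) (K \<omega>) > ennreal (\<delta>/2)) < \<epsilon>/2"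
      using \<open>0 < \<epsilon>\<close> by (intro order_tendstoD(2)[where y = 0]) auto
    then obtain t1 where t1: "\<And>t. t1 \<le> t \<Longrightarrow>
        \<P>(\<omega> in M. semi_dist (pullback t B \<omega>) (K \<omega>) > ennreal (\<delta>/2)) < \<epsilon>/2"
      by (auto simp: eventually_at_top_linorder)
    \<comment> \<open>The maximum with 1 makes the threshold positive, and thus the time
      nonnegative.\<close>
    have "1 - \<epsilon> \<le> \<P>(\<omega> in M. \<phi> t \<omega> ` B \<subseteq> closed_nbhd C \<delta>)" if t: "max t1 1 \<le> t" for t
    proof (rule prob_of_whp[OF sets_image_subset_closed_nbhd])
      show "0 \<le> t" using t by simp
      note [measurable] = borel_measurable_semi_dist_pullback[OF K \<open>0 \<le> t\<close>, of B]
      have "whp (\<epsilon>/2) (\<lambda>\<omega>. semi_dist (pullback t B \<omega>) (K \<omega>) \<le> ennreal (\<delta>/2))"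
        unfolding whp_def
        using t1[of t] t
        by (intro bexI[of _ "{\<omega> \<in> space M. semi_dist (pullback t B \<omega>) (K \<omega>) > ennreal (\<delta>/2)}"])
           (auto simp: not_less)
      from whp_conj[OF this C(2)]
      have "whp \<epsilon> (\<lambda>\<omega>. pullback t B \<omega> \<subseteq> closed_nbhd C \<delta>)"
      proof (rule whp_mono)
        fix \<omega> assume *: "semi_dist (pullback t B \<omega>) (K \<omega>) \<le> ennreal (\<delta>/2) \<and> K \<omega> \<subseteq> C"
        then have "approx_in \<delta> (pullback t B \<omega>) (K \<omega>)"
          using \<open>0 < \<delta>\<close> by (intro approx_in_of_semi_dist[of _ _ "\<delta>/2"]) auto
        then have "approx_in \<delta> (pullback t B \<omega>) C" by (rule approx_in_mono) (use * in auto)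
        then show "pullback t B \<omega> \<subseteq> closed_nbhd C \<delta>" by (rule subset_closed_nbhd_of_approx_in)
      qed simp
      from whp_theta[OF this, of t]
      show "whp \<epsilon> (\<lambda>\<omega>. \<phi> t \<omega> ` B \<subseteq> closed_nbhd C \<delta>)"
        by (rule whp_mono) (simp_all add: pullback_theta)
    qed
    then show ?thesis by (intro exI[of _ "max t1 1"]) auto
  qed
  then show ?thesis using C(1) by blast
qed

section \<open>The attractor as a limit of pullback images\<close>

text \<open>\<open>step\<close> yields almost sure convergence of the sets \<open>K i\<close>,
  \<open>absorb_bounded\<close> the attraction by the limit, and \<open>absorb_seq\<close> its
  invariance: the extra time \<open>r\<close> covers the shift caused by the dynamics.\<close>

lemma attractor_of_absorbing_sequence:
  assumes C: "\<And>i. compact (C i)" "\<And>i. C i \<noteq> {}" and \<tau>: "\<And>i. 0 \<le> \<tau> i" and e: "e \<longlonglongrightarrow> (0::real)"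
    and absorb_seq: "\<And>k s r \<eta>. 0 \<le> s \<Longrightarrow> 0 \<le> r \<Longrightarrow> 0 < \<eta> \<Longrightarrow> \<forall>\<^sub>F l in sequentially.
      whp (e k + \<eta>) (\<lambda>\<omega>. approx_in \<eta> (pullback (\<tau> l + r) (C l) \<omega>) (pullback s (C k) \<omega>))"
    and absorb_bounded: "\<And>k s \<eta> B. 0 \<le> s \<Longrightarrow> 0 < \<eta> \<Longrightarrow> bounded B \<Longrightarrow> \<forall>\<^sub>F t in at_top.
      whp (e k + \<eta>) (\<lambda>\<omega>. approx_in \<eta> (pullback t B \<omega>) (pullback s (C k) \<omega>))"
    and step: "\<And>i. whp (2 * (1/2)^i) (\<lambda>\<omega>. approx_in ((1/2)^i)
      (pullback (\<tau> (Suc i)) (C (Suc i)) \<omega>) (pullback (\<tau> i) (C i) \<omega>))"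
  shows "\<exists>A. weak_B_attractor M \<theta> \<phi> A"
proof -
  define K where "K i = pullback (\<tau> i) (C i)" for i
  have K: "compact (K i \<omega>)" "K i \<omega> \<noteq> {}" if "\<omega> \<in> space M" for i \<omega>
    unfolding K_def using that \<tau> C by (auto intro: compact_pullback) (auto simp: pullback_def)
  have "summable (\<lambda>i. 2 * (1/2::real)^i)" by (intro summable_mult summable_geometric) simp
  from AE_eventually_of_whp_summable[OF step this]
  have "AE \<omega> in M. \<forall>\<^sub>F i in sequentially. approx_in ((1/2)^i) (K (Suc i) \<omega>) (K i \<omega>)"
    by (simp add: K_def)
  then obtain N where N: "{\<omega> \<in> space M. \<not> (\<forall>\<^sub>F i in sequentially. approx_in ((1/2)^i) (K (Suc i) \<omega>) (K i \<omega>))} \<subseteq> N"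
    "emeasure M N = 0" "N \<in> events" by (rule AE_E)
  have AE_N: "AE \<omega> in M. \<omega> \<notin> N" using N(2,3) by (intro AE_not_in) auto
  \<comment> \<open>The empty value on the null event keeps \<open>A \<omega>\<close> compact for
    every \<omega>; there \<open>pt_dist\<close> is constantly \<open>top\<close>, so measurability
    survives.\<close>
  define A where "A \<omega> = (if \<omega> \<in> N then {} else limit_set (\<lambda>i. K i \<omega>))" for \<omega>
  have A: "compact (A \<omega>)" "A \<omega> \<noteq> {}"
    "0 < \<eta> \<Longrightarrow> \<forall>\<^sub>F k in sequentially. approx_in \<eta> (K k \<omega>) (A \<omega>) \<and> approx_in \<eta> (A \<omega>) (K k \<omega>)"
    if "\<omega> \<in> space M" "\<omega> \<notin> N" for \<omega> \<eta>
  proof -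
    have "\<forall>\<^sub>F i in sequentially. approx_in ((1/2)^i) (K (Suc i) \<omega>) (K i \<omega>)"
      using N(1) that by blast
    note * = limit_set_Hausdorff[of "\<lambda>i. K i \<omega>", OF K[OF that(1)] this]
    show "compact (A \<omega>)" "A \<omega> \<noteq> {}"
      "0 < \<eta> \<Longrightarrow> \<forall>\<^sub>F k in sequentially. approx_in \<eta> (K k \<omega>) (A \<omega>) \<and> approx_in \<eta> (A \<omega>) (K k \<omega>)"
      using * that(2) by (simp_all add: A_def)
  qed
  have rs: "compact_random_set M A"
    unfolding compact_random_set_def
  proof (intro conjI ballI allI)
    show "compact (A \<omega>)" if "\<omega> \<in> space M" for \<omega>
      using A(1)[OF that] by (cases "\<omega> \<in> N") (auto simp: A_def)
    show "AE \<omega> in M. A \<omega> \<noteq> {}" using AE_N by (rule AE_mp) (auto intro!: AE_I2 dest: A(2))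
    fix x
    have [measurable]: "(\<lambda>\<omega>. pt_dist x (K k \<omega>)) \<in> borel_measurable M" for k
      unfolding K_def by (rule borel_measurable_pt_dist_pullback[OF \<tau>])
    note [measurable] = N(3)
    have "pt_dist x (A \<omega>) = (if \<omega> \<in> N then top else liminf (\<lambda>k. pt_dist x (K k \<omega>)))"
      if "\<omega> \<in> space M" for \<omega>
    proof (cases "\<omega> \<in> N")
      case True
      then show ?thesis by (simp add: A_def pt_dist_def)
    next
      case False
      then show ?thesis using liminf_pt_dist_Hausdorff[OF A(3)[OF that False]] by simp
    qed
    then show "(\<lambda>\<omega>. pt_dist x (A \<omega>)) \<in> borel_measurable M"
      by (subst measurable_cong) (assumption, measurable)
  qed
  have conv: "\<forall>\<^sub>F k in sequentially. whp \<epsilon> (\<lambda>\<omega>. approx_in \<eta> (K k \<omega>) (A \<omega>) \<and> approx_in \<eta> (A \<omega>) (K k \<omega>))"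
    if "0 < \<eta>" "0 < \<epsilon>" for \<eta> \<epsilon>
  proof -
    \<comment> \<open>\<open>Q\<close> expresses Hausdorff closeness through semi-distances, which
      are measurable; the halved radius returns strict closeness.\<close>
    define Q where "Q k \<omega> \<longleftrightarrow> semi_dist (K k \<omega>) (A \<omega>) \<le> ennreal (\<eta>/2) \<and>
        semi_dist (A \<omega>) (K k \<omega>) \<le> ennreal (\<eta>/2)" for k \<omega>
    have mK: "(\<lambda>\<omega>. pt_dist x (K k \<omega>)) \<in> borel_measurable M" for k x
      unfolding K_def by (rule borel_measurable_pt_dist_pullback[OF \<tau>])
    have "\<forall>\<^sub>F k in sequentially. whp \<epsilon> (Q k)"
    proof (rule whp_eventually[OF _ _ \<open>0 < \<epsilon>\<close>])
      have [measurable]: "(\<lambda>\<omega>. semi_dist (K k \<omega>) (A \<omega>)) \<in> borel_measurable M"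
        "(\<lambda>\<omega>. semi_dist (A \<omega>) (K k \<omega>)) \<in> borel_measurable M" for k
        by (intro borel_measurable_semi_dist mK compact_random_setD(2)[OF rs])+
      show "{\<omega> \<in> space M. Q k \<omega>} \<in> events" for k unfolding Q_def by measurable
      show "AE \<omega> in M. \<forall>\<^sub>F k in sequentially. Q k \<omega>"
        using AE_N
      proof (rule AE_mp, intro AE_I2 impI)
        fix \<omega> assume "\<omega> \<in> space M" "\<omega> \<notin> N"
        from A(3)[OF this half_gt_zero[OF \<open>0 < \<eta>\<close>]]
        show "\<forall>\<^sub>F k in sequentially. Q k \<omega>"
          by eventually_elim (simp add: Q_def semi_dist_le_of_approx_in)
      qed
    qed
    then show ?thesis
    proof eventually_elim
      case (elim k)
      show ?case
      proof (rule whp_mono[OF elim order_refl])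
        fix \<omega> assume "Q k \<omega>"
        then show "approx_in \<eta> (K k \<omega>) (A \<omega>) \<and> approx_in \<eta> (A \<omega>) (K k \<omega>)"
          unfolding Q_def using \<open>0 < \<eta>\<close> by (intro conjI approx_in_of_semi_dist[of _ _ "\<eta>/2"]) auto
      qed
    qed
  qed
  have small: "\<forall>\<^sub>F j in sequentially. e j \<le> \<epsilon>" if "0 < \<epsilon>" for \<epsilon>
    using order_tendstoD(2)[OF e that] by (rule eventually_mono) simp
  have attract: "\<forall>\<^sub>F t in at_top. whp \<epsilon> (\<lambda>\<omega>. approx_in \<eta> (pullback t B \<omega>) (A \<omega>))"
    if "0 < \<eta>" "0 < \<epsilon>" "bounded B" for \<eta> \<epsilon> B
  proof -
    \<comment> \<open>Two approximations add up to \<eta>; the failure probabilities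
      \<open>e j + \<zeta>\<close> and \<open>\<zeta>\<close> add up to at most
      \<open>3 * \<zeta>\<close>.\<close>
    define \<zeta> where "\<zeta> = min (\<eta>/2) (\<epsilon>/3)"
    have \<zeta>: "0 < \<zeta>" "2 * \<zeta> \<le> \<eta>" "3 * \<zeta> \<le> \<epsilon>" using that by (auto simp: \<zeta>_def)
    obtain j where j: "e j \<le> \<zeta>" "whp \<zeta> (\<lambda>\<omega>. approx_in \<zeta> (K j \<omega>) (A \<omega>) \<and> approx_in \<zeta> (A \<omega>) (K j \<omega>))"
      using eventually_happens'[OF _ eventually_conj[OF small[OF \<zeta>(1)] conv[OF \<zeta>(1,1)]]] by auto
    show ?thesis
      using absorb_bounded[OF \<tau> \<zeta>(1) that(3), of j j]
    proof eventually_elim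
      case (elim t)
      show ?case
      proof (rule whp_mono[OF whp_conj[OF elim j(2)]])
        fix \<omega> assume "approx_in \<zeta> (pullback t B \<omega>) (pullback (\<tau> j) (C j) \<omega>) \<and>
          approx_in \<zeta> (K j \<omega>) (A \<omega>) \<and> approx_in \<zeta> (A \<omega>) (K j \<omega>)"
        then show "approx_in \<eta> (pullback t B \<omega>) (A \<omega>)"
          unfolding K_def using \<zeta>(2) by (elim conjE) (erule approx_in_trans, assumption, simp)
      qed (use j(1) \<zeta>(3) in auto)
    qed
  qed
  have "strictly_invariant M \<theta> \<phi> A"
    unfolding strictly_invariant_def
  proof (intro allI impI)
    fix t :: real assume t: "0 \<le> t"
    \<comment> \<open>The modulus of continuity needs a deterministic compact set, so the random set
      \<open>A \<omega>\<close> is first confined to \<open>H\<close> by tightness.\<close>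
    have image_conv: "\<forall>\<^sub>F k in sequentially. whp \<epsilon> (\<lambda>\<omega>. approx_in \<eta> (\<phi> t \<omega> ` A \<omega>) (\<phi> t \<omega> ` K k \<omega>) \<and>
        approx_in \<eta> (\<phi> t \<omega> ` K k \<omega>) (\<phi> t \<omega> ` A \<omega>))"
      if "0 < \<eta>" "0 < \<epsilon>" for \<eta> \<epsilon>
    proof -
      have \<epsilon>3: "0 < \<epsilon>/3" using \<open>0 < \<epsilon>\<close> by simp
      obtain H where H: "compact H" "whp (\<epsilon>/3) (\<lambda>\<omega>. A \<omega> \<subseteq> H)"
        using compact_random_set_tight[OF rs \<epsilon>3] by blast
      obtain \<delta> where \<delta>: "0 < \<delta>" "whp (\<epsilon>/3) (\<lambda>\<omega>. \<forall>S T. S \<subseteq> H \<or> T \<subseteq> H \<longrightarrow> approx_in \<delta> S T \<longrightarrow>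
          approx_in \<eta> (\<phi> t \<omega> ` S) (\<phi> t \<omega> ` T))"
        using whp_image_approx_in[OF H(1) t \<open>0 < \<eta>\<close> \<epsilon>3] by blast
      show ?thesis
        using conv[OF \<delta>(1) \<epsilon>3]
      proof eventually_elim
        case (elim k)
        from whp_conj[OF whp_conj[OF H(2) \<delta>(2)] this] show ?case
          by (rule whp_mono) auto
      qed
    qed
    have "AE \<omega> in M. approx_in \<eta> (\<phi> t \<omega> ` A \<omega>) (A (\<theta> t \<omega>)) \<and> approx_in \<eta> (A (\<theta> t \<omega>)) (\<phi> t \<omega> ` A \<omega>)"
      if "0 < \<eta>" for \<eta>
    proof (rule AE_of_whp)
      fix n
      \<comment> \<open>Each inclusion uses three approximations and fails with probability at most
        \<open>4 * \<zeta>\<close>, as \<open>e j \<le> \<zeta>\<close>; both together cost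
        \<open>8 * \<zeta>\<close>.\<close>
      define \<zeta> where "\<zeta> = min (\<eta>/3) (1 / real (Suc n) / 8)"
      have \<zeta>: "0 < \<zeta>" "\<zeta> + \<zeta> + \<zeta> \<le> \<eta>" "8 * \<zeta> \<le> 1 / real (Suc n)"
        using \<open>0 < \<eta>\<close> by (auto simp: \<zeta>_def min_def field_simps)
      have shifted: "\<forall>\<^sub>F k in sequentially. whp \<zeta> (\<lambda>\<omega>. approx_in \<zeta> (K k (\<theta> t \<omega>)) (A (\<theta> t \<omega>)) \<and>
          approx_in \<zeta> (A (\<theta> t \<omega>)) (K k (\<theta> t \<omega>)))"
        using conv[OF \<zeta>(1,1)] by eventually_elim (rule whp_theta)
      have image_K: "\<phi> t \<omega> ` K k \<omega> = pullback (\<tau> k + t) (C k) (\<theta> t \<omega>)" if "\<omega> \<in> space M" for k \<omega>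
        unfolding K_def using image_pullback[OF that \<tau> t] by (simp add: add.commute)
      obtain j where j: "e j \<le> \<zeta>"
        "whp \<zeta> (\<lambda>\<omega>. approx_in \<zeta> (K j (\<theta> t \<omega>)) (A (\<theta> t \<omega>)) \<and> approx_in \<zeta> (A (\<theta> t \<omega>)) (K j (\<theta> t \<omega>)))"
        "whp \<zeta> (\<lambda>\<omega>. approx_in \<zeta> (\<phi> t \<omega> ` A \<omega>) (\<phi> t \<omega> ` K j \<omega>) \<and>
          approx_in \<zeta> (\<phi> t \<omega> ` K j \<omega>) (\<phi> t \<omega> ` A \<omega>))"
        using eventually_happens'[OF _ eventually_conj[OF small[OF \<zeta>(1)]
              eventually_conj[OF shifted image_conv[OF \<zeta>(1,1)]]]] by auto
      \<comment> \<open>The index \<open>j\<close> is fixed first and \<open>k\<close> is sent to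
        infinity. Forward, the later family carries the extra time \<open>t\<close>; backward, the
        absorbing set does.\<close>
      have forward: "\<forall>\<^sub>F k in sequentially.
          whp (e j + \<zeta>) (\<lambda>\<omega>. approx_in \<zeta> (pullback (\<tau> k + t) (C k) (\<theta> t \<omega>)) (K j (\<theta> t \<omega>)))"
        using absorb_seq[OF \<tau> t \<zeta>(1), of j j] unfolding K_def by eventually_elim (rule whp_theta)
      have backward: "\<forall>\<^sub>F k in sequentially.
          whp (e j + \<zeta>) (\<lambda>\<omega>. approx_in \<zeta> (K k (\<theta> t \<omega>)) (pullback (\<tau> j + t) (C j) (\<theta> t \<omega>)))"
        using absorb_seq[OF add_nonneg_nonneg[OF \<tau> t] order_refl \<zeta>(1), of j j]
        unfolding K_def add_0_right by eventually_elim (rule whp_theta)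
      obtain k where k: "whp (e j + \<zeta>) (\<lambda>\<omega>. approx_in \<zeta> (pullback (\<tau> k + t) (C k) (\<theta> t \<omega>)) (K j (\<theta> t \<omega>)))"
        "whp (e j + \<zeta>) (\<lambda>\<omega>. approx_in \<zeta> (K k (\<theta> t \<omega>)) (pullback (\<tau> j + t) (C j) (\<theta> t \<omega>)))"
        "whp \<zeta> (\<lambda>\<omega>. approx_in \<zeta> (K k (\<theta> t \<omega>)) (A (\<theta> t \<omega>)) \<and> approx_in \<zeta> (A (\<theta> t \<omega>)) (K k (\<theta> t \<omega>)))"
        "whp \<zeta> (\<lambda>\<omega>. approx_in \<zeta> (\<phi> t \<omega> ` A \<omega>) (\<phi> t \<omega> ` K k \<omega>) \<and>
          approx_in \<zeta> (\<phi> t \<omega> ` K k \<omega>) (\<phi> t \<omega> ` A \<omega>))"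
        using eventually_happens'[OF _ eventually_conj[OF eventually_conj[OF forward backward]
              eventually_conj[OF shifted image_conv[OF \<zeta>(1,1)]]]] by auto
      \<comment> \<open>Route: from the image of \<open>A \<omega>\<close> to that of
        \<open>K k \<omega>\<close>, then to \<open>K j\<close> and finally to \<open>A\<close>,
        both over \<open>\<theta> t \<omega>\<close>.\<close>
      have "whp (\<zeta> + (e j + \<zeta>) + \<zeta>) (\<lambda>\<omega>. approx_in \<eta> (\<phi> t \<omega> ` A \<omega>) (A (\<theta> t \<omega>)))"
      proof (rule whp_mono[OF whp_conj[OF whp_conj[OF k(4) k(1)] j(2)] order_refl], elim conjE)
        fix \<omega> assume "\<omega> \<in> space M" and 1: "approx_in \<zeta> (\<phi> t \<omega> ` A \<omega>) (\<phi> t \<omega> ` K k \<omega>)"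
          and 2: "approx_in \<zeta> (pullback (\<tau> k + t) (C k) (\<theta> t \<omega>)) (K j (\<theta> t \<omega>))"
          and 3: "approx_in \<zeta> (K j (\<theta> t \<omega>)) (A (\<theta> t \<omega>))"
        show "approx_in \<eta> (\<phi> t \<omega> ` A \<omega>) (A (\<theta> t \<omega>))"
          using approx_in_trans[OF approx_in_trans[OF 1 _ order_refl] 3 \<zeta>(2)] 2
          by (simp add: image_K[OF \<open>\<omega> \<in> space M\<close>])
      qed
      \<comment> \<open>Route: from \<open>A\<close> to \<open>K k\<close>, both over
        \<open>\<theta> t \<omega>\<close>, then to the image of \<open>K j \<omega>\<close>, and
        finally to that of \<open>A \<omega>\<close>.\<close>
      moreover have "whp (\<zeta> + (e j + \<zeta>) + \<zeta>) (\<lambda>\<omega>. approx_in \<eta> (A (\<theta> t \<omega>)) (\<phi> t \<omega> ` A \<omega>))"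
      proof (rule whp_mono[OF whp_conj[OF whp_conj[OF k(3) k(2)] j(3)] order_refl], elim conjE)
        fix \<omega> assume "\<omega> \<in> space M" and 1: "approx_in \<zeta> (A (\<theta> t \<omega>)) (K k (\<theta> t \<omega>))"
          and 2: "approx_in \<zeta> (K k (\<theta> t \<omega>)) (pullback (\<tau> j + t) (C j) (\<theta> t \<omega>))"
          and 3: "approx_in \<zeta> (\<phi> t \<omega> ` K j \<omega>) (\<phi> t \<omega> ` A \<omega>)"
        show "approx_in \<eta> (A (\<theta> t \<omega>)) (\<phi> t \<omega> ` A \<omega>)"
          using approx_in_trans[OF approx_in_trans[OF 1 2 order_refl] _ \<zeta>(2)] 3
          by (simp add: image_K[OF \<open>\<omega> \<in> space M\<close>])
      qed
      ultimately show "whp (1 / real (Suc n)) (\<lambda>\<omega>. approx_in \<eta> (\<phi> t \<omega> ` A \<omega>) (A (\<theta> t \<omega>)) \<and>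
          approx_in \<eta> (A (\<theta> t \<omega>)) (\<phi> t \<omega> ` A \<omega>))"
        by (rule whp_mono[OF whp_conj]) (use j(1) \<zeta>(3) in auto)
    qed
    then have "AE \<omega> in M. \<forall>n. approx_in (1 / real (Suc n)) (\<phi> t \<omega> ` A \<omega>) (A (\<theta> t \<omega>)) \<and>
        approx_in (1 / real (Suc n)) (A (\<theta> t \<omega>)) (\<phi> t \<omega> ` A \<omega>)"
      unfolding AE_all_countable by simp
    then show "AE \<omega> in M. \<phi> t \<omega> ` A \<omega> = A (\<theta> t \<omega>)"
    proof (rule AE_mp, intro AE_I2 impI)
      fix \<omega> assume \<omega>: "\<omega> \<in> space M"
        and *: "\<forall>n. approx_in (1 / real (Suc n)) (\<phi> t \<omega> ` A \<omega>) (A (\<theta> t \<omega>)) \<and>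
          approx_in (1 / real (Suc n)) (A (\<theta> t \<omega>)) (\<phi> t \<omega> ` A \<omega>)"
      have "closed (A (\<theta> t \<omega>))"
        using compact_random_setD(1)[OF rs theta_space[OF \<omega>]] by (rule compact_imp_closed)
      moreover have "closed (\<phi> t \<omega> ` A \<omega>)"
        using continuous_rds[OF \<omega> t] compact_random_setD(1)[OF rs \<omega>]
        by (intro compact_imp_closed compact_continuous_image) (auto intro: continuous_on_subset)
      ultimately show "\<phi> t \<omega> ` A \<omega> = A (\<theta> t \<omega>)"
        using * by (intro antisym subset_of_approx_in) auto
    qed
  qed
  moreover have "tendsto_zero_in_prob M (\<lambda>t \<omega>. SUP x\<in>B. pt_dist (\<phi> t \<omega> x) (A (\<theta> t \<omega>)))"
    if "bounded B" for B
    unfolding tendsto_zero_in_prob_def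
  proof (intro allI impI tendstoI)
    fix c r :: real assume c: "0 < c" and r: "0 < r"
    show "\<forall>\<^sub>F t in at_top. dist \<P>(\<omega> in M. (SUP x\<in>B. pt_dist (\<phi> t \<omega> x) (A (\<theta> t \<omega>))) > ennreal c) 0 < r"
      using attract[OF c half_gt_zero[OF r] that]
    proof eventually_elim
      case (elim t)
      from whp_theta[OF this, of t]
      have "whp (r/2) (\<lambda>\<omega>. \<not> ennreal c < (SUP x\<in>B. pt_dist (\<phi> t \<omega> x) (A (\<theta> t \<omega>))))"
      proof (rule whp_mono[OF _ order_refl])
        fix \<omega> assume "\<omega> \<in> space M" "approx_in c (pullback t B (\<theta> t \<omega>)) (A (\<theta> t \<omega>))"
        then have "semi_dist (\<phi> t \<omega> ` B) (A (\<theta> t \<omega>)) \<le> ennreal c"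
          by (simp add: pullback_theta semi_dist_le_of_approx_in)
        then show "\<not> ennreal c < (SUP x\<in>B. pt_dist (\<phi> t \<omega> x) (A (\<theta> t \<omega>)))"
          by (simp add: semi_dist_def image_comp not_less)
      qed
      from prob_le_of_whp_not[OF this] show ?case using r by (simp add: measure_nonneg)
    qed
  qed
  ultimately show ?thesis using rs by (auto simp: weak_B_attractor_def)
qed

section \<open>Choice of compact sets, times and a subsequence\<close>

lemma tight_imp_attractor:
  assumes tight: "\<And>\<epsilon>. 0 < \<epsilon> \<Longrightarrow> \<exists>C. compact C \<and> (\<forall>\<delta> B. 0 < \<delta> \<longrightarrow> bounded B \<longrightarrow>
    (\<exists>t\<^sub>0>0. \<forall>t\<ge>t\<^sub>0. 1 - \<epsilon> \<le> \<P>(\<omega> in M. \<phi> t \<omega> ` B \<subseteq> closed_nbhd C \<delta>)))"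
  shows "\<exists>A. weak_B_attractor M \<theta> \<phi> A"
proof -
  \<comment> \<open>The exponent \<open>Suc k\<close> keeps \<open>e 0\<close> below 1, which forces
    every \<open>C k\<close> to be nonempty.\<close>
  define e where "e k = (1/2::real) ^ Suc k" for k
  have e: "0 < e k" "e k < 1" for k
    unfolding e_def using power_le_one[of "1/2::real" k] by auto
  define P where "P a C \<longleftrightarrow> compact C \<and> (\<forall>\<delta> B. 0 < \<delta> \<longrightarrow> bounded B \<longrightarrow>
    (\<exists>t\<^sub>0>0. \<forall>t\<ge>t\<^sub>0. 1 - a \<le> \<P>(\<omega> in M. \<phi> t \<omega> ` B \<subseteq> closed_nbhd C \<delta>)))" for a C
  have "\<exists>C. P (e k) C" for k unfolding P_def by (rule tight[OF e(1)])
  then obtain C where P: "\<And>k. P (e k) (C k)" by metis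
  have C: "compact (C k)"
    "\<And>\<delta> B. 0 < \<delta> \<Longrightarrow> bounded B \<Longrightarrow>
      \<exists>t\<^sub>0>0. \<forall>t\<ge>t\<^sub>0. 1 - e k \<le> \<P>(\<omega> in M. \<phi> t \<omega> ` B \<subseteq> closed_nbhd (C k) \<delta>)" for k
    using P[of k] unfolding P_def by blast+
  have neC: "C k \<noteq> {}" for k
  proof
    assume "C k = {}"
    then have empty: "closed_nbhd (C k) 1 = {}" by (auto simp: closed_nbhd_def pt_dist_def top_unique)
    obtain t where "1 - e k \<le> \<P>(\<omega> in M. \<phi> t \<omega> ` {undefined} \<subseteq> closed_nbhd (C k) 1)"
      using C(2)[OF zero_less_one bounded_insert[THEN iffD2, OF bounded_empty]] by blast
    then show False using empty e(2)[of k] by simp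
  qed
  have absorb: "\<exists>t\<^sub>0>0. \<forall>t\<ge>t\<^sub>0. whp (e k) (\<lambda>\<omega>. approx_in \<delta> (\<phi> t \<omega> ` B) (C k))"
    if prems: "0 < \<delta>" "bounded B" for k \<delta> B
  proof -
    obtain t\<^sub>0 where t0: "0 < t\<^sub>0"
      "\<And>t. t\<^sub>0 \<le> t \<Longrightarrow> 1 - e k \<le> \<P>(\<omega> in M. \<phi> t \<omega> ` B \<subseteq> closed_nbhd (C k) (\<delta>/2))"
      using C(2)[OF half_gt_zero[OF prems(1)] prems(2), of k] by blast
    have "whp (e k) (\<lambda>\<omega>. approx_in \<delta> (\<phi> t \<omega> ` B) (C k))" if "t\<^sub>0 \<le> t" for t
    proof (rule whp_mono[OF whp_of_prob[OF sets_image_subset_closed_nbhd t0(2)[OF that]] order_refl])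
      show "0 \<le> t" using t0(1) that by simp
      fix \<omega> assume "\<phi> t \<omega> ` B \<subseteq> closed_nbhd (C k) (\<delta>/2)"
      then show "approx_in \<delta> (\<phi> t \<omega> ` B) (C k)"
        unfolding subset_closed_nbhd_iff by (rule approx_in_of_semi_dist) (use \<open>0 < \<delta>\<close> in auto)
    qed
    then show ?thesis using t0(1) by blast
  qed
  have "\<forall>k l. \<exists>t\<^sub>0>0. \<forall>t\<ge>t\<^sub>0. whp (e k) (\<lambda>\<omega>. approx_in (1 / real (Suc l)) (\<phi> t \<omega> ` C l) (C k))"
    by (intro allI absorb compact_imp_bounded C(1)) simp
  then obtain T where T: "\<And>k l. 0 < T k l"
    "\<And>k l t. T k l \<le> t \<Longrightarrow> whp (e k) (\<lambda>\<omega>. approx_in (1 / real (Suc l)) (\<phi> t \<omega> ` C l) (C k))"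
    by metis
  \<comment> \<open>The sum dominates \<open>T k l\<close> for all \<open>k \<le> l\<close> at once;
    the summand \<open>real l\<close> leaves room to subtract any fixed time
    \<open>s\<close>.\<close>
  define \<tau> where "\<tau> l = real l + (\<Sum>k\<le>l. T k l)" for l
  have \<tau>: "0 \<le> \<tau> l" for l
    using sum_nonneg[of "{..l}" "\<lambda>k. T k l"] less_imp_le[OF T(1)] by (simp add: \<tau>_def)
  have T_le: "real l + T k l \<le> \<tau> l" if "k \<le> l" for k l
    using member_le_sum[of k "{..l}" "\<lambda>k. T k l"] that less_imp_le[OF T(1)] by (simp add: \<tau>_def)
  have absorb_seq: "\<forall>\<^sub>F l in sequentially.
      whp (e k + \<eta>) (\<lambda>\<omega>. approx_in \<eta> (pullback (\<tau> l + r) (C l) \<omega>) (pullback s (C k) \<omega>))"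
    if prems: "0 \<le> s" "0 \<le> r" "0 < \<eta>" for k s r \<eta>
  proof -
    obtain \<delta> where \<delta>: "0 < \<delta>" "\<And>u B a. 0 \<le> u \<Longrightarrow> whp a (\<lambda>\<omega>. approx_in \<delta> (\<phi> u \<omega> ` B) (C k)) \<Longrightarrow>
        whp (a + \<eta>) (\<lambda>\<omega>. approx_in \<eta> (pullback (s + u) B \<omega>) (pullback s (C k) \<omega>))"
      using pullback_absorbed[OF C(1) prems(1,3)] by blast
    have "\<forall>\<^sub>F l in sequentially. 1 / real (Suc l) < \<delta>"
      using LIMSEQ_Suc[OF lim_1_over_n] \<delta>(1) by (rule order_tendstoD)
    moreover have "\<forall>\<^sub>F l in sequentially. s \<le> real l"
      using filterlim_real_sequentially by (simp add: filterlim_at_top)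
    ultimately show ?thesis
      using eventually_ge_at_top[of k]
    proof eventually_elim
      case (elim l)
      \<comment> \<open>The time elapsed between the start at \<open>-(\<tau> l + r)\<close> and the
        intermediate time \<open>-s\<close>.\<close>
      define u where "u = \<tau> l + r - s"
      have u: "T k l \<le> u" "s + u = \<tau> l + r"
        using T_le[OF elim(3)] elim(2) prems(2) by (auto simp: u_def)
      have "0 \<le> u" using u(1) T(1)[of k l] by simp
      moreover have "whp (e k) (\<lambda>\<omega>. approx_in \<delta> (\<phi> u \<omega> ` C l) (C k))"
        by (rule whp_mono[OF T(2)[OF u(1)] order_refl], erule approx_in_mono)
           (use elim(1) in auto)
      ultimately show ?case using \<delta>(2)[of u "e k" "C l"] u(2) by simp
    qed
  qed
  have absorb_bounded: "\<forall>\<^sub>F t in at_top.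
      whp (e k + \<eta>) (\<lambda>\<omega>. approx_in \<eta> (pullback t B \<omega>) (pullback s (C k) \<omega>))"
    if prems: "0 \<le> s" "0 < \<eta>" "bounded B" for k s \<eta> B
  proof -
    obtain \<delta> where \<delta>: "0 < \<delta>" "\<And>u B a. 0 \<le> u \<Longrightarrow> whp a (\<lambda>\<omega>. approx_in \<delta> (\<phi> u \<omega> ` B) (C k)) \<Longrightarrow>
        whp (a + \<eta>) (\<lambda>\<omega>. approx_in \<eta> (pullback (s + u) B \<omega>) (pullback s (C k) \<omega>))"
      using pullback_absorbed[OF C(1) prems(1,2)] by blast
    obtain t\<^sub>0 where t0: "0 < t\<^sub>0"
      "\<And>t. t\<^sub>0 \<le> t \<Longrightarrow> whp (e k) (\<lambda>\<omega>. approx_in \<delta> (\<phi> t \<omega> ` B) (C k))"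
      using absorb[OF \<delta>(1) prems(3), of k] by blast
    show ?thesis
      using eventually_ge_at_top[of "s + t\<^sub>0"]
    proof eventually_elim
      case (elim t)
      show ?case
        using \<delta>(2)[of "t - s" "e k" B] t0(2)[of "t - s"] t0(1) elim by simp
    qed
  qed
  \<comment> \<open>\<open>R i k l\<close> marks \<open>l\<close> as an admissible successor of
    \<open>k\<close> at stage \<open>i\<close>. Iterating a choice gives a subsequence whose stage
    errors are summable, since \<open>\<sigma> i \<ge> i\<close> bounds
    \<open>e (\<sigma> i)\<close> by \<open>(1/2)^i\<close>.\<close>
  define R where "R i k l \<longleftrightarrow> k < l \<and> whp (e k + (1/2)^i)
      (\<lambda>\<omega>. approx_in ((1/2)^i) (pullback (\<tau> l) (C l) \<omega>) (pullback (\<tau> k) (C k) \<omega>))" for i k l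
  have "\<exists>l. R i k l" for i k
    using eventually_happens'[OF _ eventually_conj[OF eventually_gt_at_top[of k]
          absorb_seq[OF \<tau> order_refl, of "(1/2)^i" k k]]] by (simp add: R_def)
  then obtain g where g: "\<And>i k. R i k (g i k)" by metis
  define \<sigma> where "\<sigma> = rec_nat 0 g"
  have "R i (\<sigma> i) (\<sigma> (Suc i))" for i using g by (simp add: \<sigma>_def)
  then have \<sigma>: "\<sigma> i < \<sigma> (Suc i)" "whp (e (\<sigma> i) + (1/2)^i) (\<lambda>\<omega>. approx_in ((1/2)^i)
      (pullback (\<tau> (\<sigma> (Suc i))) (C (\<sigma> (Suc i))) \<omega>) (pullback (\<tau> (\<sigma> i)) (C (\<sigma> i)) \<omega>))" for i
    unfolding R_def by blast+
  have mono: "strict_mono \<sigma>" using \<sigma>(1) by (simp add: strict_mono_Suc_iff)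
  have e\<sigma>: "e (\<sigma> i) \<le> (1/2)^i" for i
    unfolding e_def using seq_suble[OF mono, of i] by (intro power_decreasing) auto
  show ?thesis
  proof (rule attractor_of_absorbing_sequence[of "\<lambda>i. C (\<sigma> i)" "\<lambda>i. \<tau> (\<sigma> i)" "\<lambda>i. e (\<sigma> i)"])
    have lim: "(\<lambda>i. (1/2::real)^i) \<longlonglongrightarrow> 0" by (rule LIMSEQ_power_zero) simp
    show "(\<lambda>i. e (\<sigma> i)) \<longlonglongrightarrow> 0"
      by (rule tendsto_sandwich[OF _ _ tendsto_const lim]) (simp_all add: e\<sigma> less_imp_le[OF e(1)])
    show "whp (2 * (1/2)^i) (\<lambda>\<omega>. approx_in ((1/2)^i)
        (pullback (\<tau> (\<sigma> (Suc i))) (C (\<sigma> (Suc i))) \<omega>) (pullback (\<tau> (\<sigma> i)) (C (\<sigma> i)) \<omega>))" for i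
      by (rule whp_mono[OF \<sigma>(2)]) (use e\<sigma>[of i] in auto)
    show "\<forall>\<^sub>F l in sequentially. whp (e (\<sigma> k) + \<eta>)
        (\<lambda>\<omega>. approx_in \<eta> (pullback (\<tau> (\<sigma> l) + r) (C (\<sigma> l)) \<omega>) (pullback s (C (\<sigma> k)) \<omega>))"
      if "0 \<le> s" "0 \<le> r" "0 < \<eta>" for k s r \<eta>
      by (rule eventually_subseq[OF mono absorb_seq[OF that]])
    show "\<forall>\<^sub>F t in at_top. whp (e (\<sigma> k) + \<eta>)
        (\<lambda>\<omega>. approx_in \<eta> (pullback t B \<omega>) (pullback s (C (\<sigma> k)) \<omega>))"
      if "0 \<le> s" "0 < \<eta>" "bounded B" for k s \<eta> B
      by (rule absorb_bounded[OF that])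
  qed (rule C(1) neC \<tau>)+
qed

end

theorem theorem4p2:
  fixes M :: "'w measure"
    and \<theta> :: "real \<Rightarrow> 'w \<Rightarrow> 'w"
    and \<phi> :: "real \<Rightarrow> 'w \<Rightarrow> 'e::polish_space \<Rightarrow> 'e"
  assumes "continuous_rds M \<theta> \<phi>"
  shows
    "((\<exists>A. weak_B_attractor M \<theta> \<phi> A) \<longleftrightarrow>
      (\<forall>\<epsilon>::real. \<epsilon> > 0 \<longrightarrow>
        (\<exists>C. compact C \<and>
          (\<forall>\<delta>::real. \<forall>B. \<delta> > 0 \<longrightarrow> bounded B \<longrightarrow>
            (\<exists>t\<^sub>0>0. \<forall>t\<ge>t\<^sub>0.
              \<P>(\<omega> in M. \<phi> t \<omega> ` B \<subseteq> closed_nbhd C \<delta>) \<ge> 1 - \<epsilon>)))))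
     \<and>
     ((\<exists>A. weak_B_attractor M \<theta> \<phi> A) \<longleftrightarrow>
      (\<exists>K. compact_random_set M K \<and> (\<forall>B. bounded B \<longrightarrow> weakly_attracts M \<theta> \<phi> K B)))"
    (is "(?attractor \<longleftrightarrow> ?tight) \<and> (?attractor \<longleftrightarrow> ?attracting)")
proof -
  interpret continuous_rds M \<theta> \<phi> by fact
  have "?attracting" if ?attractor
    using that weakly_attracts_of_weak_B_attractor unfolding weak_B_attractor_def by blast
  moreover have "?tight" if ?attracting
  proof (intro allI impI)
    fix \<epsilon> :: real assume "0 < \<epsilon>"
    obtain K where "compact_random_set M K" "\<And>B. bounded B \<Longrightarrow> weakly_attracts M \<theta> \<phi> K B"
      using \<open>?attracting\<close> by blast
    from attracting_imp_tight[OF this \<open>0 < \<epsilon>\<close>]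
    show "\<exists>C. compact C \<and> (\<forall>\<delta> B. 0 < \<delta> \<longrightarrow> bounded B \<longrightarrow>
      (\<exists>t\<^sub>0>0. \<forall>t\<ge>t\<^sub>0. 1 - \<epsilon> \<le> \<P>(\<omega> in M. \<phi> t \<omega> ` B \<subseteq> closed_nbhd C \<delta>)))" .
  qed
  moreover have "?attractor" if tight: ?tight
    by (rule tight_imp_attractor) (rule tight[rule_format])
  \<comment> \<open>The three implications form a cycle, from which both equivalences follow
    propositionally.\<close>
  ultimately show ?thesis by argo
qed

end
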